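(* Let $G$ be a finite group, $k$ a field, and $V$ a finitely generated $\mathrm{FI}_G$-module over $k$. Let $d=hd_0(V)$ be its generating degree and $r=hd_1(V)$ its first homological degree. Then there is a polynomial $P_V(x)\in\mathbb Q[x]$ such that $\dim_k V_n=P_V(n)$ for all $n\ge r+\min\{r,d\}$.
   Context: $\mathrm{FI}_G$ is the category with objects $[n]=\{1,\dots,n\}$ ($n\ge0$) and morphisms $[n]\to[m]$ the pairs $(f,g)$ with $f:[n]\to[m]$ injective and $g:[n]\to G$ a map of sets; composition $(f,g)\circ(f',g')=(f\circ f',h)$, $h(x)=g'(x)\,g(f'(x))$. An $\mathrm{FI}_G$-module over $k$ is a functor $V:\mathrm{FI}_G\to\mathrm{Mod}_k$, $V_n:=V([n])$. $M(n)$ is the $\mathrm{FI}_G$-module $M(n)_m=k[\mathrm{Hom}_{\mathrm{FI}_G}([n],[m])]$; $V$ is finitely generated if there is a surjection from a finite direct sum of modules $M(n_i)$. $\deg V=\sup\{n:V_n\ne0\}$. $H_0(V)_n=V_n/V_{<n}$, where $V_{<n}$ is the span of images of all $V(f,g)$ with $(f,g):[m]\to[n]$, $m<n$; $H_i$ are the left derived functors of $H_0$, and $hd_i(V)=\deg H_i(V)$. *)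

theory Defs
  imports Main "HOL-Algebra.Group" "HOL-Library.FuncSet" "HOL-Library.Function_Algebras"
    "HOL-Library.Extended_Real" "HOL-Computational_Algebra.Polynomial"
begin

type_synonym 'g fimor = "(nat \<Rightarrow> nat) \<times> (nat \<Rightarrow> 'g)"

definition homs :: "('g, 'b) monoid_scheme \<Rightarrow> nat \<Rightarrow> nat \<Rightarrow> 'g fimor set" where
  "homs G n m = {(f, g). f \<in> {1..n} \<rightarrow>\<^sub>E {1..m} \<and> inj_on f {1..n} \<and> g \<in> {1..n} \<rightarrow>\<^sub>E carrier G}"

definition fcomp :: "('g, 'b) monoid_scheme \<Rightarrow> nat \<Rightarrow> 'g fimor \<Rightarrow> 'g fimor \<Rightarrow> 'g fimor" where
  "fcomp G n \<psi> \<phi> = (restrict (fst \<psi> \<circ> fst \<phi>) {1..n},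
                      restrict (\<lambda>x. snd \<phi> x \<otimes>\<^bsub>G\<^esub> snd \<psi> (fst \<phi> x)) {1..n})"

definition fid :: "('g, 'b) monoid_scheme \<Rightarrow> nat \<Rightarrow> 'g fimor" where
  "fid G n = (restrict id {1..n}, restrict (\<lambda>_. \<one>\<^bsub>G\<^esub>) {1..n})"

definition fig_module ::
  "('g, 'b) monoid_scheme \<Rightarrow> ('k::field \<Rightarrow> 'v::ab_group_add \<Rightarrow> 'v) \<Rightarrow> (nat \<Rightarrow> 'v set)
    \<Rightarrow> (nat \<Rightarrow> nat \<Rightarrow> 'g fimor \<Rightarrow> 'v \<Rightarrow> 'v) \<Rightarrow> bool" where
  "fig_module G scale V act \<longleftrightarrow>
     vector_space scale \<and>
     (\<forall>n. module.subspace scale (V n)) \<and>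
     (\<forall>n m. \<forall>\<phi>\<in>homs G n m.
        (\<forall>v\<in>V n. act n m \<phi> v \<in> V m) \<and>
        (\<forall>v\<in>V n. \<forall>w\<in>V n. act n m \<phi> (v + w) = act n m \<phi> v + act n m \<phi> w) \<and>
        (\<forall>c. \<forall>v\<in>V n. act n m \<phi> (scale c v) = scale c (act n m \<phi> v))) \<and>
     (\<forall>n. \<forall>v\<in>V n. act n n (fid G n) v = v) \<and>
     (\<forall>n m l. \<forall>\<phi>\<in>homs G n m. \<forall>\<psi>\<in>homs G m l. \<forall>v\<in>V n.
        act n l (fcomp G n \<psi> \<phi>) v = act m l \<psi> (act n m \<phi> v))"

text \<open>Finitely generated: a finite set of elements (n_i, v_i), v_i \<in> V n_i, whose images span
  every V m; equivalently a surjection from a finite direct sum of the M(n_i).\<close>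
definition fig_fin_gen ::
  "('g, 'b) monoid_scheme \<Rightarrow> ('k::field \<Rightarrow> 'v::ab_group_add \<Rightarrow> 'v) \<Rightarrow> (nat \<Rightarrow> 'v set)
    \<Rightarrow> (nat \<Rightarrow> nat \<Rightarrow> 'g fimor \<Rightarrow> 'v \<Rightarrow> 'v) \<Rightarrow> bool" where
  "fig_fin_gen G scale V act \<longleftrightarrow>
     (\<exists>S. finite S \<and> (\<forall>(n, v)\<in>S. v \<in> V n) \<and>
        (\<forall>m. V m = module.span scale (\<Union>(n, v)\<in>S. (\<lambda>\<phi>. act n m \<phi> v) ` homs G n m)))"

definition lowpart ::
  "('g, 'b) monoid_scheme \<Rightarrow> ('k::comm_ring_1 \<Rightarrow> 'w::ab_group_add \<Rightarrow> 'w) \<Rightarrow> (nat \<Rightarrow> 'w set)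
    \<Rightarrow> (nat \<Rightarrow> nat \<Rightarrow> 'g fimor \<Rightarrow> 'w \<Rightarrow> 'w) \<Rightarrow> nat \<Rightarrow> 'w set" where
  "lowpart G scale W act n =
     module.span scale (\<Union>m\<in>{..<n}. \<Union>\<phi>\<in>homs G m n. act m n \<phi> ` W m)"

text \<open>Degree of a graded object given by its set of nonzero degrees; deg 0 = -infinity.\<close>
definition degset :: "nat set \<Rightarrow> ereal" where
  "degset S = Sup ((\<lambda>n. ereal (real n)) ` S)"

text \<open>hd_0(V) = deg H_0(V), where H_0(V)_n = V_n / V_{<n}.\<close>
definition hd0 ::
  "('g, 'b) monoid_scheme \<Rightarrow> ('k::field \<Rightarrow> 'v::ab_group_add \<Rightarrow> 'v) \<Rightarrow> (nat \<Rightarrow> 'v set)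
    \<Rightarrow> (nat \<Rightarrow> nat \<Rightarrow> 'g fimor \<Rightarrow> 'v \<Rightarrow> 'v) \<Rightarrow> ereal" where
  "hd0 G scale V act = degset {n. lowpart G scale V act n \<noteq> V n}"

text \<open>Canonical free module F = (direct sum over all (n, v) with v \<in> V n) of M(n).
  An element of F_m is a finitely supported k-valued function on pairs ((n, v), phi) with
  v \<in> V n and phi \<in> Hom([n],[m]).  F acts by post-composition on the basis.\<close>

type_synonym ('v, 'g) fbasis = "(nat \<times> 'v) \<times> 'g fimor"

definition fscale :: "'k::field \<Rightarrow> ('x \<Rightarrow> 'k) \<Rightarrow> ('x \<Rightarrow> 'k)" where
  "fscale a c = (\<lambda>x. a * c x)"

definition freeF ::
  "('g, 'b) monoid_scheme \<Rightarrow> (nat \<Rightarrow> 'v set) \<Rightarrow> nat \<Rightarrow> (('v, 'g) fbasis \<Rightarrow> 'k::field) set" where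
  "freeF G V m = {c. finite {x. c x \<noteq> 0} \<and>
      (\<forall>x. c x \<noteq> 0 \<longrightarrow> snd (fst x) \<in> V (fst (fst x)) \<and> snd x \<in> homs G (fst (fst x)) m)}"

definition freeAct ::
  "('g, 'b) monoid_scheme \<Rightarrow> nat \<Rightarrow> nat \<Rightarrow> 'g fimor \<Rightarrow> (('v, 'g) fbasis \<Rightarrow> 'k::field)
     \<Rightarrow> (('v, 'g) fbasis \<Rightarrow> 'k)" where
  "freeAct G m l \<psi> c =
     (\<lambda>y. \<Sum>x\<in>{x. c x \<noteq> 0 \<and> (fst x, fcomp G (fst (fst x)) \<psi> (snd x)) = y}. c x)"

definition augm ::
  "('k::field \<Rightarrow> 'v::ab_group_add \<Rightarrow> 'v) \<Rightarrow> (nat \<Rightarrow> nat \<Rightarrow> 'g fimor \<Rightarrow> 'v \<Rightarrow> 'v) \<Rightarrow> nat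
     \<Rightarrow> (('v, 'g) fbasis \<Rightarrow> 'k) \<Rightarrow> 'v" where
  "augm scale act m c = (\<Sum>x\<in>{x. c x \<noteq> 0}. scale (c x) (act (fst (fst x)) m (snd x) (snd (fst x))))"

definition kerK ::
  "('g, 'b) monoid_scheme \<Rightarrow> ('k::field \<Rightarrow> 'v::ab_group_add \<Rightarrow> 'v) \<Rightarrow> (nat \<Rightarrow> 'v set)
    \<Rightarrow> (nat \<Rightarrow> nat \<Rightarrow> 'g fimor \<Rightarrow> 'v \<Rightarrow> 'v) \<Rightarrow> nat \<Rightarrow> (('v, 'g) fbasis \<Rightarrow> 'k) set" where
  "kerK G scale V act m = {c \<in> freeF G V m. augm scale act m c = 0}"

text \<open>Since F is projective (free), from 0 -> K -> F -> V -> 0 we get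
  H_1(V)_m = ker(H_0(K)_m -> H_0(F)_m) = (K_m \<inter> F_{<m}) / K_{<m}.  hd_1(V) = deg H_1(V).\<close>
definition hd1 ::
  "('g, 'b) monoid_scheme \<Rightarrow> ('k::field \<Rightarrow> 'v::ab_group_add \<Rightarrow> 'v) \<Rightarrow> (nat \<Rightarrow> 'v set)
    \<Rightarrow> (nat \<Rightarrow> nat \<Rightarrow> 'g fimor \<Rightarrow> 'v \<Rightarrow> 'v) \<Rightarrow> ereal" where
  "hd1 G scale V act = degset {m.
      kerK G scale V act m \<inter> lowpart G fscale (freeF G V) (freeAct G) m
        \<noteq> lowpart G fscale (kerK G scale V act) (freeAct G) m}"

end

theory Submission
  imports Defs
begin

text \<open>
  Restricting along bijections \<open>{1..card X} \<rightarrow> X\<close> turns an \<open>FI\<^sub>G\<close>-module into a functor \<open>X \<mapsto> W X\<close>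
  on finite sets of naturals and injections, and its homology is that of the Koszul complex
  \<open>\<dots> \<rightarrow> \<Oplus>\<^bsub>x,y\<^esub> W (Z - {x, y}) \<rightarrow> \<Oplus>\<^bsub>x\<^esub> W (Z - {x}) \<rightarrow> W Z\<close>. Let \<open>S\<close> be the shift \<open>X \<mapsto> W (X \<union> {s})\<close> and let
  \<open>K\<close> and \<open>D\<close> be the kernel and cokernel of \<open>W \<rightarrow> S W\<close>. Since the structure maps of \<open>K\<close> vanish,
  there is an exact sequence
  \<open>H\<^sub>1 K \<rightarrow> S H\<^sub>2 W \<rightarrow> H\<^sub>2 D \<rightarrow> K \<rightarrow> S H\<^sub>1 W \<rightarrow> H\<^sub>1 D \<rightarrow> 0\<close>.
  Passing to \<open>D\<close> lowers the generation degree \<open>d\<close> and the relation degree \<open>r\<close> by one, so induction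
  yields \<open>H\<^sub>2 W = 0\<close> in degrees above \<open>r + min r d + 1\<close> and \<open>K = 0\<close> in degrees from \<open>r + min r d\<close> on. There
  \<open>dim W\<^sub>n\<^sub>+\<^sub>1 - dim W\<^sub>n = dim D\<^sub>n\<close>, which is polynomial by induction. The \<open>a\<close>-fold iterate of \<open>D\<close> is
  represented without quotients by a pair \<open>E \<subseteq> Z\<close> with \<open>card E = a\<close>: its value on \<open>Z - E\<close> is \<open>W Z\<close>
  modulo the images of \<open>W (Z - {e})\<close>, \<open>e \<in> E\<close>.
\<close>

section \<open>The Koszul complex\<close>

locale fi_functor = vector_space scale
  for scale :: "'k::field \<Rightarrow> 'v::ab_group_add \<Rightarrow> 'v" +
  fixes W :: "nat set \<Rightarrow> 'v set"
    and M :: "nat set \<Rightarrow> nat set \<Rightarrow> (nat \<Rightarrow> nat) \<Rightarrow> 'v \<Rightarrow> 'v"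
  assumes W_subspace: "subspace (W X)"
    and M_linear: "module_hom scale scale (M X Y f)"
    and M_in: "\<lbrakk>finite X; finite Y; inj_on f X; f ` X \<subseteq> Y; v \<in> W X\<rbrakk> \<Longrightarrow> M X Y f v \<in> W Y"
    and M_comp: "\<lbrakk>finite X; finite Y; finite Z; inj_on f X; f ` X \<subseteq> Y; inj_on g Y; g ` Y \<subseteq> Z; v \<in> W X\<rbrakk>
      \<Longrightarrow> M Y Z g (M X Y f v) = M X Z (g \<circ> f) v"
    and M_id: "\<lbrakk>finite X; v \<in> W X\<rbrakk> \<Longrightarrow> M X X id v = v"
    and M_cong: "\<lbrakk>finite X; finite Y; inj_on f X; f ` X \<subseteq> Y; \<And>x. x \<in> X \<Longrightarrow> f x = g x; v \<in> W X\<rbrakk>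
      \<Longrightarrow> M X Y f v = M X Y g v"
begin

abbreviation L :: "nat set \<Rightarrow> nat set \<Rightarrow> 'v \<Rightarrow> 'v" where
  "L X Y \<equiv> M X Y id"

lemmas M_add = module_hom.add[OF M_linear]
lemmas M_sum = module_hom.sum[OF M_linear]
lemmas M_diff = module_hom.diff[OF M_linear]
lemmas M_neg = module_hom.neg[OF M_linear]
lemmas M_0 [simp] = module_hom.zero[OF M_linear]

lemmas W_0 [simp] = subspace_0[OF W_subspace]
lemmas W_add = subspace_add[OF W_subspace]
lemmas W_diff = subspace_diff[OF W_subspace]
lemmas W_neg = subspace_neg[OF W_subspace]
lemmas W_sum = subspace_sum[OF W_subspace]

lemma L_in: "\<lbrakk>finite Y; X \<subseteq> Y; v \<in> W X\<rbrakk> \<Longrightarrow> L X Y v \<in> W Y"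
  by (rule M_in) (auto intro: finite_subset)

lemma L_L: "\<lbrakk>finite Z; X \<subseteq> Y; Y \<subseteq> Z; v \<in> W X\<rbrakk> \<Longrightarrow> L Y Z (L X Y v) = L X Z v"
  by (subst M_comp) (auto intro: finite_subset)

section \<open>Sums of images of faces\<close>

text \<open>One vector per \<open>e\<close> is enough, because each summand ranges over the image of
  a subspace. The explicit sum keeps the coefficients at hand when relations are turned into Koszul
  cycles.\<close>

definition faces :: "nat set \<Rightarrow> nat set \<Rightarrow> 'v set" where
  "faces E Z = {v. \<exists>b. (\<forall>e\<in>E. b e \<in> W (Z - {e})) \<and> v = (\<Sum>e\<in>E. L (Z - {e}) Z (b e))}"

lemma facesI: "\<lbrakk>\<And>e. e \<in> E \<Longrightarrow> b e \<in> W (Z - {e})\<rbrakk> \<Longrightarrow> (\<Sum>e\<in>E. L (Z - {e}) Z (b e)) \<in> faces E Z"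
  unfolding faces_def by blast

lemma facesE:
  assumes "v \<in> faces E Z"
  obtains b where "\<And>e. e \<in> E \<Longrightarrow> b e \<in> W (Z - {e})" "v = (\<Sum>e\<in>E. L (Z - {e}) Z (b e))"
  using assms unfolding faces_def by blast

lemma faces_subspace: "subspace (faces E Z)"
proof (rule subspaceI)
  show "0 \<in> faces E Z" using facesI[of E "\<lambda>_. 0" Z] by simp
next
  fix x y assume "x \<in> faces E Z" "y \<in> faces E Z"
  obtain b where b: "\<And>e. e \<in> E \<Longrightarrow> b e \<in> W (Z - {e})" "x = (\<Sum>e\<in>E. L (Z - {e}) Z (b e))"
    using \<open>x \<in> faces E Z\<close> by (elim facesE) blast
  obtain c where c: "\<And>e. e \<in> E \<Longrightarrow> c e \<in> W (Z - {e})" "y = (\<Sum>e\<in>E. L (Z - {e}) Z (c e))"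
    using \<open>y \<in> faces E Z\<close> by (elim facesE) blast
  have "(\<Sum>e\<in>E. L (Z - {e}) Z (b e + c e)) \<in> faces E Z" using b c by (intro facesI W_add)
  then show "x + y \<in> faces E Z" using b c by (simp add: M_add sum.distrib)
next
  fix c x assume "x \<in> faces E Z"
  then obtain b where b: "\<And>e. e \<in> E \<Longrightarrow> b e \<in> W (Z - {e})" "x = (\<Sum>e\<in>E. L (Z - {e}) Z (b e))"
    by (elim facesE) blast
  have "(\<Sum>e\<in>E. L (Z - {e}) Z (scale c (b e))) \<in> faces E Z"
    using b by (intro facesI subspace_scale[OF W_subspace])
  then show "scale c x \<in> faces E Z" using b by (simp add: module_hom.scale[OF M_linear] scale_sum_right)
qed

lemmas faces_0 [simp] = subspace_0[OF faces_subspace]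
lemmas faces_add = subspace_add[OF faces_subspace]
lemmas faces_neg = subspace_neg[OF faces_subspace]
lemmas faces_sum = subspace_sum[OF faces_subspace]

lemma faces_empty [simp]: "faces {} Z = {0}"
  unfolding faces_def by auto

lemma faces_subset: "\<lbrakk>finite Z; E \<subseteq> Z\<rbrakk> \<Longrightarrow> faces E Z \<subseteq> W Z"
  unfolding faces_def by (auto intro!: W_sum L_in)

lemma faces_one:
  assumes "finite E" "e \<in> E" "v \<in> W (Z - {e})"
  shows "L (Z - {e}) Z v \<in> faces E Z"
proof -
  have "(\<Sum>a\<in>E. L (Z - {a}) Z (if a = e then v else 0)) \<in> faces E Z"
    by (rule facesI) (use assms in auto)
  also have "(\<Sum>a\<in>E. L (Z - {a}) Z (if a = e then v else 0)) = (\<Sum>a\<in>E. if a = e then L (Z - {e}) Z v else 0)"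
    by (rule sum.cong) auto
  finally show ?thesis using assms by simp
qed

text \<open>By injectivity \<open>f\<close> carries \<open>Z - {e}\<close> into
  \<open>Z' - {f e}\<close>, so on a face of \<open>Z\<close> the map factors through a face of
  \<open>Z'\<close>.\<close>

lemma M_faces:
  assumes fin: "finite Z" "finite Z'" and f: "inj_on f Z" "f ` Z \<subseteq> Z'" and E: "E \<subseteq> Z"
    and v: "v \<in> faces E Z"
  shows "M Z Z' f v \<in> faces (f ` E) Z'"
proof -
  obtain b where b: "\<And>e. e \<in> E \<Longrightarrow> b e \<in> W (Z - {e})" "v = (\<Sum>e\<in>E. L (Z - {e}) Z (b e))"
    using v by (elim facesE) blast
  have "M Z Z' f (L (Z - {e}) Z (b e)) \<in> faces (f ` E) Z'" if e: "e \<in> E" for e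
  proof -
    have eZ: "e \<in> Z" using e E by auto
    have i: "inj_on f (Z - {e})" using f(1) by (rule inj_on_subset) auto
    have s: "f ` (Z - {e}) \<subseteq> Z' - {f e}" using f eZ by (auto simp: inj_on_def)
    have "M Z Z' f (L (Z - {e}) Z (b e)) = M (Z - {e}) Z' f (b e)"
      using fin f b(1)[OF e] by (subst M_comp) auto
    also have "\<dots> = L (Z' - {f e}) Z' (M (Z - {e}) (Z' - {f e}) f (b e))"
      using fin s i b(1)[OF e] by (subst M_comp) auto
    also have "\<dots> \<in> faces (f ` E) Z'"
      using e fin b(1)[OF e] E i s by (intro faces_one M_in) (auto intro: finite_subset)
    finally show ?thesis .
  qed
  then show ?thesis by (auto simp: b(2) M_sum intro: faces_sum)
qed

lemma L_faces: "\<lbrakk>finite Z'; E \<subseteq> Z; Z \<subseteq> Z'; v \<in> faces E Z\<rbrakk> \<Longrightarrow> L Z Z' v \<in> faces E Z'"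
  using M_faces[of Z Z' id E v] by (auto intro: finite_subset)

text \<open>Koszul chains of degree 2 and 3 on the set \<open>Z\<close>, encoded as alternating families.\<close>

definition alt2 :: "nat set \<Rightarrow> (nat \<Rightarrow> nat \<Rightarrow> 'v) \<Rightarrow> bool" where
  "alt2 Z w \<longleftrightarrow> (\<forall>x\<in>Z. w x x = 0) \<and> (\<forall>x\<in>Z. \<forall>y\<in>Z. w x y = - w y x \<and> w x y \<in> W (Z - {x, y}))"

definition alt3 :: "nat set \<Rightarrow> (nat \<Rightarrow> nat \<Rightarrow> nat \<Rightarrow> 'v) \<Rightarrow> bool" where
  "alt3 Z u \<longleftrightarrow> (\<forall>x\<in>Z. \<forall>z\<in>Z. u x x z = 0) \<and>
     (\<forall>x\<in>Z. \<forall>y\<in>Z. \<forall>z\<in>Z. u x y z = - u y x z \<and> u x y z = - u x z y \<and> u x y z \<in> W (Z - {x, y, z}))"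

text \<open>The index \<open>y = x\<close> may stay in the sum: on alternating families its term is
  zero.\<close>

definition d2 :: "nat set \<Rightarrow> (nat \<Rightarrow> nat \<Rightarrow> 'v) \<Rightarrow> nat \<Rightarrow> 'v" where
  "d2 Z w x = (\<Sum>y\<in>Z. L (Z - {x, y}) (Z - {x}) (w x y))"

definition d3 :: "nat set \<Rightarrow> (nat \<Rightarrow> nat \<Rightarrow> nat \<Rightarrow> 'v) \<Rightarrow> nat \<Rightarrow> nat \<Rightarrow> 'v" where
  "d3 Z u x y = (\<Sum>z\<in>Z. L (Z - {x, y, z}) (Z - {x, y}) (u x y z))"

lemma alt2D:
  assumes "alt2 Z w" "x \<in> Z" "y \<in> Z"
  shows "w x x = 0" "w x y = - w y x" "w x y \<in> W (Z - {x, y})"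
  using assms unfolding alt2_def by blast+

lemma alt3D:
  assumes "alt3 Z u" "x \<in> Z" "y \<in> Z" "z \<in> Z"
  shows "u x x z = 0" "u x y z = - u y x z" "u x y z = - u x z y" "u x y z \<in> W (Z - {x, y, z})"
  using assms unfolding alt3_def by blast+

section \<open>Cancellation in the Koszul complex\<close>

text \<open>Comparing the sum with its negative would only show that its double is zero, which says
  nothing in characteristic two. When one point is added at a time, its row and column cancel and
  its diagonal entry vanishes.\<close>

lemma alternating_double_sum_0:
  fixes a :: "'i \<Rightarrow> 'i \<Rightarrow> 'c::ab_group_add"
  assumes "finite S" "\<And>x. x \<in> S \<Longrightarrow> a x x = 0" "\<And>x y. \<lbrakk>x \<in> S; y \<in> S\<rbrakk> \<Longrightarrow> a x y = - a y x"
  shows "(\<Sum>x\<in>S. \<Sum>y\<in>S. a x y) = 0"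
  using assms
proof (induction S rule: finite_induct)
  case empty
  show ?case by simp
next
  case (insert s S)
  have 1: "(\<Sum>y\<in>S. a s y) = - (\<Sum>y\<in>S. a y s)"
    unfolding sum_negf[symmetric] by (rule sum.cong[OF refl]) (rule insert.prems(2), auto)
  have 2: "(\<Sum>x\<in>S. \<Sum>y\<in>S. a x y) = 0" using insert by blast
  have 3: "a s s = 0" using insert by blast
  show ?case using insert.hyps 1 2 3 by (simp add: sum.distrib)
qed

lemma alt2_diff:
  assumes w: "alt2 Z w" and w': "alt2 Z w'"
  shows "alt2 Z (\<lambda>x y. w x y - w' x y)"
  unfolding alt2_def
proof (intro conjI ballI)
  fix x y assume xy: "x \<in> Z" "y \<in> Z"
  note a = alt2D[OF w xy] and b = alt2D[OF w' xy]
  show "w x y - w' x y = - (w y x - w' y x)" unfolding a(2) b(2) by simp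
  show "w x y - w' x y \<in> W (Z - {x, y})" using a(3) b(3) by (rule W_diff)
qed (use alt2D(1)[OF w] alt2D(1)[OF w'] in simp)

lemma d2_diff: "d2 Z (\<lambda>x y. w x y - w' x y) x = d2 Z w x - d2 Z w' x"
  unfolding d2_def by (simp add: M_diff sum_subtractf)

lemma alt3_add:
  assumes u: "alt3 Z u" and u': "alt3 Z u'"
  shows "alt3 Z (\<lambda>x y z. u x y z + u' x y z)"
  unfolding alt3_def
proof (intro conjI ballI)
  fix x y z assume xyz: "x \<in> Z" "y \<in> Z" "z \<in> Z"
  note a = alt3D[OF u xyz] and b = alt3D[OF u' xyz]
  show "u x y z + u' x y z = - (u y x z + u' y x z)" unfolding a(2) b(2) by simp
  show "u x y z + u' x y z = - (u x z y + u' x z y)" unfolding a(3) b(3) by simp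
  show "u x y z + u' x y z \<in> W (Z - {x, y, z})" using a(4) b(4) by (rule W_add)
qed (use alt3D(1)[OF u] alt3D(1)[OF u'] in simp)

lemma d3_add: "d3 Z (\<lambda>x y z. u x y z + u' x y z) x y = d3 Z u x y + d3 Z u' x y"
  unfolding d3_def by (simp add: M_add sum.distrib)

lemma alt2_d3:
  assumes "finite Z" "alt3 Z u"
  shows "alt2 Z (d3 Z u)"
  unfolding alt2_def
proof (intro conjI ballI)
  fix x assume "x \<in> Z" then show "d3 Z u x x = 0"
    unfolding d3_def by (simp add: alt3D(1)[OF assms(2)])
next
  fix x y assume xy: "x \<in> Z" "y \<in> Z"
  have "L (Z - {x, y, z}) (Z - {x, y}) (u x y z) = - L (Z - {y, x, z}) (Z - {y, x}) (u y x z)" if "z \<in> Z" for z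
  proof -
    have "u x y z = - u y x z" using alt3D[OF assms(2)] xy that by blast
    then show ?thesis by (simp add: M_neg insert_commute)
  qed
  then show "d3 Z u x y = - d3 Z u y x" unfolding d3_def by (simp add: sum_negf[symmetric])
  show "d3 Z u x y \<in> W (Z - {x, y})"
    unfolding d3_def using assms alt3D(4)[OF assms(2)] xy by (auto intro!: W_sum L_in)
qed

text \<open>Once \<open>L_L\<close> has composed the two inclusions, the summand is alternating in
  the two summation points.\<close>

lemma d2_d3:
  assumes "finite Z" "alt3 Z u" "x \<in> Z"
  shows "d2 Z (d3 Z u) x = 0"
proof -
  have "d2 Z (d3 Z u) x = (\<Sum>y\<in>Z. \<Sum>z\<in>Z. L (Z - {x, y, z}) (Z - {x}) (u x y z))"
    unfolding d2_def d3_def M_sum using assms(1) alt3D(4)[OF assms(2,3)]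
    by (intro sum.cong refl L_L) auto
  also have "\<dots> = 0"
  proof (rule alternating_double_sum_0[OF assms(1)])
    fix y z assume yz: "y \<in> Z" "z \<in> Z"
    have "u x y z = - u x z y" using alt3D[OF assms(2)] assms yz by blast
    moreover have "{x, y, z} = {x, z, y}" by blast
    ultimately show "L (Z - {x, y, z}) (Z - {x}) (u x y z) = - L (Z - {x, z, y}) (Z - {x}) (u x z y)"
      by (simp add: M_neg)
  next
    fix y assume y: "y \<in> Z"
    have "u x y y = - u y x y" "u y x y = - u y y x" "u y y x = 0"
      using alt3D[OF assms(2)] assms(3) y by blast+
    then show "L (Z - {x, y, y}) (Z - {x}) (u x y y) = 0" by simp
  qed
  finally show ?thesis .
qed

section \<open>Vanishing conditions for homology and kernels\<close>

definition H1_zero :: "nat set \<Rightarrow> bool" where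
  "H1_zero Z \<longleftrightarrow> (\<forall>c. (\<forall>z\<in>Z. c z \<in> W (Z - {z})) \<and> (\<Sum>z\<in>Z. L (Z - {z}) Z (c z)) = 0
     \<longrightarrow> (\<exists>w. alt2 Z w \<and> (\<forall>z\<in>Z. c z = d2 Z w z)))"

text \<open>With \<open>E = Z - Y\<close> and \<open>Y \<subseteq> Z\<close> this is the vanishing
  on \<open>Y\<close> of the second Koszul homology of the \<open>card E\<close>-fold iterated
  cokernel. The entries \<open>w x e\<close> with \<open>e\<close> in \<open>E\<close> are
  coefficients witnessing congruences modulo \<open>faces E\<close>, so neither cycles nor
  boundaries need a quotient space.\<close>

definition H2_zero :: "nat set \<Rightarrow> nat set \<Rightarrow> bool" where
  "H2_zero Z Y \<longleftrightarrow> (\<forall>w. alt2 Z w \<and> (\<forall>x\<in>Y. d2 Z w x = 0)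
     \<longrightarrow> (\<exists>u. alt3 Z u \<and> (\<forall>x\<in>Y. \<forall>y\<in>Y. w x y = d3 Z u x y)))"

text \<open>For \<open>s\<close> outside \<open>E\<close>, adding the point \<open>s\<close> is
  injective on the \<open>card E\<close>-fold iterated cokernel at
  \<open>Z - insert s E\<close>.\<close>

definition K_zero :: "nat set \<Rightarrow> nat set \<Rightarrow> nat \<Rightarrow> bool" where
  "K_zero E Z s \<longleftrightarrow> (\<forall>v\<in>W (Z - {s}). L (Z - {s}) Z v \<in> faces E Z \<longrightarrow> v \<in> faces E (Z - {s}))"

text \<open>Modulo faces the chain is zero on \<open>Y\<close>. The coefficients of the face
  expressions, made antisymmetric in the two points of \<open>Y\<close>, supply the 3-chain that it
  bounds.\<close>

lemma H2_zero_if_faces: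
  assumes fin: "finite Z" and Y: "Y \<subseteq> Z" and w: "alt2 Z w"
    and face: "\<And>x y. \<lbrakk>x \<in> Y; y \<in> Y; x \<noteq> y\<rbrakk> \<Longrightarrow> w x y \<in> faces (Z - Y) (Z - {x, y})"
  shows "\<exists>u. alt3 Z u \<and> (\<forall>x\<in>Y. \<forall>y\<in>Y. w x y = d3 Z u x y)"
proof -
  define P where "P x y \<beta> \<longleftrightarrow> (\<forall>e\<in>Z - Y. \<beta> e \<in> W (Z - {x, y} - {e})) \<and>
      w x y = (\<Sum>e\<in>Z - Y. L (Z - {x, y} - {e}) (Z - {x, y}) (\<beta> e))" for x y \<beta>
  define \<beta> where "\<beta> x y = (SOME \<beta>. P x y \<beta>)" for x y
  have P: "P x y (\<beta> x y)" if "x \<in> Y" "y \<in> Y" "x < y" for x y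
  proof -
    have "w x y \<in> faces (Z - Y) (Z - {x, y})" using that by (intro face) auto
    then have "\<exists>\<beta>. P x y \<beta>" by (auto simp: P_def elim!: facesE)
    then show ?thesis unfolding \<beta>_def by (rule someI_ex)
  qed
  have \<beta>: "\<And>x y e. \<lbrakk>x \<in> Y; y \<in> Y; x < y; e \<in> Z - Y\<rbrakk> \<Longrightarrow> \<beta> x y e \<in> W (Z - {x, y} - {e})"
    "\<And>x y. \<lbrakk>x \<in> Y; y \<in> Y; x < y\<rbrakk> \<Longrightarrow>
      w x y = (\<Sum>e\<in>Z - Y. L (Z - {x, y} - {e}) (Z - {x, y}) (\<beta> x y e))"
    using P unfolding P_def by blast+
  \<comment> \<open>The coefficients are chosen for \<open>x < y\<close> only, and the other order
    is defined by a sign; independent choices need not be antisymmetric.\<close>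
  define b where "b x y e = (if x \<in> Y \<and> y \<in> Y \<and> e \<in> Z - Y then
      if x < y then \<beta> x y e else if y < x then - \<beta> y x e else 0 else 0)" for x y e
  have b_in: "b x y e \<in> W (Z - {x, y, e})" for x y e
  proof -
    have "Z - {x, y} - {e} = Z - {x, y, e}" "Z - {y, x} - {e} = Z - {x, y, e}" by blast+
    then show ?thesis unfolding b_def using \<beta>(1)[of x y e] \<beta>(1)[of y x e] by (auto intro: W_neg)
  qed
  have b_alt: "b x x e = 0" "b y x e = - b x y e" for x y e unfolding b_def by auto
  have b_sum: "w x y = (\<Sum>e\<in>Z. L (Z - {x, y, e}) (Z - {x, y}) (b x y e))" if xy: "x \<in> Y" "y \<in> Y" for x y
  proof -
    have *: "w x y = (\<Sum>e\<in>Z. L (Z - {x, y, e}) (Z - {x, y}) (b x y e))" if "x \<in> Y" "y \<in> Y" "x < y" for x y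
    proof -
      have "w x y = (\<Sum>e\<in>Z - Y. L (Z - {x, y, e}) (Z - {x, y}) (b x y e))"
        unfolding \<beta>(2)[OF that]
      proof (rule sum.cong[OF refl])
        fix e assume "e \<in> Z - Y"
        moreover have "Z - {x, y} - {e} = Z - {x, y, e}" by blast
        ultimately show "L (Z - {x, y} - {e}) (Z - {x, y}) (\<beta> x y e) = L (Z - {x, y, e}) (Z - {x, y}) (b x y e)"
          using that by (simp add: b_def)
      qed
      also have "\<dots> = (\<Sum>e\<in>Z. L (Z - {x, y, e}) (Z - {x, y}) (b x y e))"
        by (rule sum.mono_neutral_left) (use fin in \<open>auto simp: b_def\<close>)
      finally show ?thesis .
    qed
    consider "x < y" | "y < x" | "x = y" by linarith
    then show ?thesis
    proof cases
      case 1 then show ?thesis using * xy by blast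
    next
      case 2
      have "w x y = - w y x" using alt2D[OF w] xy Y by blast
      also have "\<dots> = (\<Sum>e\<in>Z. - L (Z - {y, x, e}) (Z - {y, x}) (b y x e))"
        unfolding *[OF xy(2,1) 2] by (simp add: sum_negf)
      also have "\<dots> = (\<Sum>e\<in>Z. L (Z - {x, y, e}) (Z - {x, y}) (b x y e))"
        by (rule sum.cong[OF refl]) (simp add: b_alt(2)[of x y] insert_commute M_neg)
      finally show ?thesis .
    next
      case 3
      have "w x x = 0" using alt2D(1)[OF w] xy Y by blast
      then show ?thesis using 3 by (simp add: b_alt(1))
    qed
  qed
  \<comment> \<open>Cyclic summation makes \<open>b\<close> alternate in all three arguments. For
    \<open>x\<close> and \<open>y\<close> in \<open>Y\<close> only \<open>b x y z\<close> survives,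
    since \<open>b\<close> vanishes when its third argument lies in \<open>Y\<close>.\<close>
  define u where "u x y z = b x y z + b y z x + b z x y" for x y z
  have "alt3 Z u"
    unfolding alt3_def
  proof (intro conjI ballI)
    fix x y z
    show "u x x z = 0" unfolding u_def using b_alt(1)[of x z] b_alt(2)[of x z x] by simp
    show "u x y z = - u y x z" unfolding u_def
      using b_alt(2)[of x y z] b_alt(2)[of y z x] b_alt(2)[of z x y] by simp
    show "u x y z = - u x z y" unfolding u_def
      using b_alt(2)[of x y z] b_alt(2)[of y z x] b_alt(2)[of z x y] by simp
    have "{y, z, x} = {x, y, z}" "{z, x, y} = {x, y, z}" by blast+
    then show "u x y z \<in> W (Z - {x, y, z})"
      unfolding u_def using b_in[of x y z] b_in[of y z x] b_in[of z x y] by (auto intro!: W_add)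
  qed
  moreover have "w x y = d3 Z u x y" if "x \<in> Y" "y \<in> Y" for x y
  proof -
    have "u x y z = b x y z" for z unfolding u_def b_def using that by auto
    then show ?thesis unfolding d3_def using b_sum[OF that] by simp
  qed
  ultimately show ?thesis by blast
qed

section \<open>Induction steps along the exact sequence\<close>

lemma d2_split:
  assumes fin: "finite Z" and xZ: "x \<in> Z" and s: "s \<in> Z" "s \<notin> X" and X: "X \<subseteq> Z"
    and w0: "\<And>y. y \<in> X \<Longrightarrow> w x y = 0"
  shows "d2 Z w x = L (Z - {x, s}) (Z - {x}) (w x s) +
    (\<Sum>e\<in>Z - insert s X. L (Z - {x, e}) (Z - {x}) (w x e))"
proof -
  have "d2 Z w x = (\<Sum>y\<in>insert s (Z - insert s X). L (Z - {x, y}) (Z - {x}) (w x y))"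
    unfolding d2_def by (rule sum.mono_neutral_right) (use assms in auto)
  then show ?thesis using fin by simp
qed

lemma d2_tail_faces:
  assumes fin: "finite Z" and w: "alt2 Z w" and x: "x \<in> Z" "x \<in> insert s X"
  shows "(\<Sum>e\<in>Z - insert s X. L (Z - {x, e}) (Z - {x}) (w x e)) \<in> faces (Z - insert s X) (Z - {x})"
proof (rule faces_sum)
  fix e assume e: "e \<in> Z - insert s X"
  have "Z - {x, e} = Z - {x} - {e}" by blast
  then show "L (Z - {x, e}) (Z - {x}) (w x e) \<in> faces (Z - insert s X) (Z - {x})"
    using faces_one[of "Z - insert s X" e "w x e" "Z - {x}"] alt2D(3)[OF w x(1), of e] e fin by auto
qed

text \<open>Modulo faces the boundary equation at \<open>x\<close> retains only the term with
  \<open>s\<close>. So \<open>w s x\<close> becomes zero when \<open>s\<close> is added, that is, it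
  represents an element of the kernel.\<close>

lemma cycle_in_K:
  assumes fin: "finite Z" and s: "s \<in> Z" "s \<notin> X" and X: "X \<subseteq> Z" and w: "alt2 Z w"
    and w0: "\<And>y. y \<in> X \<Longrightarrow> w x y = 0" and x: "x \<in> X" and d: "d2 Z w x = 0"
  shows "L (Z - {x} - {s}) (Z - {x}) (w s x) \<in> faces (Z - insert s X) (Z - {x})"
proof -
  have xZ: "x \<in> Z" using x X by auto
  have "L (Z - {x, s}) (Z - {x}) (w x s) = - (\<Sum>e\<in>Z - insert s X. L (Z - {x, e}) (Z - {x}) (w x e))"
    using d2_split[where w = w, OF fin xZ s X w0] d by (simp add: eq_neg_iff_add_eq_0)
  moreover have "w s x = - w x s" using alt2D[OF w] xZ s by blast
  moreover have "Z - {x} - {s} = Z - {x, s}" by blast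
  ultimately show ?thesis using d2_tail_faces[OF fin w xZ, of s X] x by (simp add: M_neg)
qed

text \<open>The kernel of the map adding the point \<open>s\<close> is killed by every other inclusion, because a
  transposition carries \<open>s\<close> to any other new point.\<close>
lemma kernel_killed:
  assumes fin: "finite Z" and s: "s \<in> Z" and x: "x \<in> Z" "x \<noteq> s" and E: "E \<subseteq> Z - {s, x}"
    and u: "u \<in> W (Z - {x} - {s})" and k: "L (Z - {x} - {s}) (Z - {x}) u \<in> faces E (Z - {x})"
  shows "L (Z - {x} - {s}) (Z - {s}) u \<in> faces E (Z - {s})"
proof -
  define t where "t = id(s := x)"
  have t: "inj_on t (Z - {x})" "t ` (Z - {x}) \<subseteq> Z - {s}" using s x by (auto simp: t_def inj_on_def)
  have "M (Z - {x}) (Z - {s}) t (L (Z - {x} - {s}) (Z - {x}) u) \<in> faces (t ` E) (Z - {s})"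
    by (rule M_faces) (use fin t E k in auto)
  moreover have "t ` E = E" using E by (force simp: t_def image_iff)
  moreover have "M (Z - {x}) (Z - {s}) t (L (Z - {x} - {s}) (Z - {x}) u) =
      M (Z - {x} - {s}) (Z - {s}) (t \<circ> id) u"
    by (rule M_comp) (use fin t u in auto)
  moreover have "M (Z - {x} - {s}) (Z - {s}) (t \<circ> id) u = L (Z - {x} - {s}) (Z - {s}) u"
    by (rule M_cong) (use fin t u in \<open>auto simp: t_def inj_on_def\<close>)
  ultimately show ?thesis by simp
qed

text \<open>Exactness at the kernel: a kernel element gives a 1-cycle of \<open>W\<close> on
  \<open>Z\<close>, and a filling of this cycle leaves an obstruction in \<open>H_2\<close> of the
  next cokernel. When both vanish, only terms handled by \<open>kernel_killed\<close> and faces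
  remain.\<close>

lemma K_zero_step:
  assumes fin: "finite Z" and s: "s \<in> Z" "s \<notin> X" and X: "X \<subseteq> Z"
    and H1: "H1_zero Z" and H2: "H2_zero Z X"
  shows "K_zero (Z - insert s X) Z s"
  unfolding K_zero_def
proof (intro ballI impI)
  define E where "E = Z - insert s X"
  fix v assume v: "v \<in> W (Z - {s})" and "L (Z - {s}) Z v \<in> faces (Z - insert s X) Z"
  then obtain b where b: "\<And>e. e \<in> E \<Longrightarrow> b e \<in> W (Z - {e})"
    and vb: "L (Z - {s}) Z v = (\<Sum>e\<in>E. L (Z - {e}) Z (b e))" unfolding E_def[symmetric] by (elim facesE) blast
  \<comment> \<open>The relation between \<open>v\<close> and the faces becomes a 1-cycle:
    \<open>v\<close> at \<open>s\<close>, the negated coefficients on \<open>E\<close>, zero on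
    \<open>X\<close>.\<close>
  define c where "c z = (if z = s then v else if z \<in> E then - b z else 0)" for z
  have c_in: "\<forall>z\<in>Z. c z \<in> W (Z - {z})" unfolding c_def using v b by (auto intro: W_neg)
  have "(\<Sum>z\<in>Z. L (Z - {z}) Z (c z)) = (\<Sum>z\<in>insert s E. L (Z - {z}) Z (c z))"
    by (rule sum.mono_neutral_right) (use fin s in \<open>auto simp: E_def c_def\<close>)
  also have "\<dots> = L (Z - {s}) Z v + (\<Sum>z\<in>E. L (Z - {z}) Z (- b z))"
    using fin s by (auto simp: E_def c_def intro!: sum.cong)
  also have "\<dots> = 0" by (simp add: vb M_neg sum_negf)
  finally obtain w where w: "alt2 Z w" and cw: "\<And>z. z \<in> Z \<Longrightarrow> c z = d2 Z w z"
    using H1 c_in unfolding H1_zero_def by blast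
  have c0: "c x = 0" if "x \<in> X" for x using that s by (auto simp: c_def E_def)
  have "\<forall>x\<in>X. d2 Z w x = 0" using cw[symmetric] c0 X by auto
  then obtain u where u: "alt3 Z u" and wu: "\<And>x y. \<lbrakk>x \<in> X; y \<in> X\<rbrakk> \<Longrightarrow> w x y = d3 Z u x y"
    using H2 w unfolding H2_zero_def by blast
  \<comment> \<open>Subtracting a boundary removes all entries between points of \<open>X\<close>
    and leaves \<open>d2 Z w\<close> unchanged.\<close>
  define w' where "w' x y = w x y - d3 Z u x y" for x y
  have w': "alt2 Z w'" unfolding w'_def by (intro alt2_diff alt2_d3 w u fin)
  have cw': "c z = d2 Z w' z" if "z \<in> Z" for z
    unfolding w'_def d2_diff d2_d3[OF fin u that] using cw[OF that] by simp
  have w'0: "w' x y = 0" if "x \<in> X" "y \<in> X" for x y using wu[OF that] by (simp add: w'_def)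
  have inK: "L (Z - {s, x}) (Z - {s}) (w' s x) \<in> faces E (Z - {s})" if x: "x \<in> X" for x
  proof -
    have xZ: "x \<in> Z" using x X by auto
    have "L (Z - {x} - {s}) (Z - {x}) (w' s x) \<in> faces E (Z - {x})"
      unfolding E_def using cycle_in_K[OF fin s X w' _ x] w'0[OF x] cw'[OF xZ] c0[OF x] by simp
    moreover have eq: "Z - {x} - {s} = Z - {s, x}" by blast
    moreover have "w' s x \<in> W (Z - {s, x})" using alt2D[OF w'] s xZ by blast
    ultimately have "L (Z - {x} - {s}) (Z - {s}) (w' s x) \<in> faces E (Z - {s})"
      by (intro kernel_killed) (use fin s x xZ in \<open>auto simp: E_def\<close>)
    then show ?thesis unfolding eq .
  qed
  \<comment> \<open>The terms over \<open>X\<close> are images of kernel elements under inclusions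
    that add a point other than \<open>s\<close>, hence faces by \<open>inK\<close>; the terms over
    \<open>E\<close> are faces directly.\<close>
  have "v = d2 Z w' s" using cw'[OF s(1)] by (simp add: c_def)
  also have "\<dots> = (\<Sum>x\<in>insert s (X \<union> E). L (Z - {s, x}) (Z - {s}) (w' s x))"
    unfolding d2_def by (rule sum.cong) (use X s in \<open>auto simp: E_def\<close>)
  also have "\<dots> = (\<Sum>x\<in>X. L (Z - {s, x}) (Z - {s}) (w' s x)) + (\<Sum>x\<in>E. L (Z - {s, x}) (Z - {s}) (w' s x))"
  proof -
    have "finite X" "finite E" using fin X by (auto simp: E_def intro: finite_subset)
    moreover have "w' s s = 0" using alt2D[OF w'] s by blast
    ultimately show ?thesis using s
      by (subst sum.insert) (auto simp: E_def intro!: sum.union_disjoint)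
  qed
  also have "\<dots> \<in> faces E (Z - {s})"
    using inK d2_tail_faces[OF fin w' s(1), of s X] unfolding E_def[symmetric]
    by (intro faces_add) (auto intro: faces_sum)
  finally show "v \<in> faces (Z - insert s X) (Z - {s})" by (simp add: E_def)
qed

text \<open>Exactness at the shift of \<open>H_2\<close>: a 2-cycle on \<open>insert s X\<close>
  restricts to a cycle of the next cokernel on \<open>X\<close>. Once that part bounds, the
  remaining entries \<open>w s x\<close> represent kernel elements at \<open>X - {x}\<close>, and
  these are zero by \<open>K\<close>.\<close>

lemma H2_zero_step:
  assumes fin: "finite Z" and s: "s \<in> Z" "s \<notin> X" and X: "X \<subseteq> Z"
    and H2: "H2_zero Z X" and K: "\<And>x. x \<in> X \<Longrightarrow> K_zero (Z - insert s X) (Z - {x}) s"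
  shows "H2_zero Z (insert s X)"
  unfolding H2_zero_def
proof (intro allI impI)
  fix w assume "alt2 Z w \<and> (\<forall>x\<in>insert s X. d2 Z w x = 0)"
  then have w: "alt2 Z w" and dw: "\<And>x. x \<in> insert s X \<Longrightarrow> d2 Z w x = 0" by auto
  obtain u where u: "alt3 Z u" and wu: "\<And>x y. \<lbrakk>x \<in> X; y \<in> X\<rbrakk> \<Longrightarrow> w x y = d3 Z u x y"
    using H2[unfolded H2_zero_def, rule_format, of w] w dw by blast
  define w' where "w' x y = w x y - d3 Z u x y" for x y
  have w': "alt2 Z w'" unfolding w'_def by (intro alt2_diff alt2_d3 w u fin)
  have dw': "d2 Z w' x = 0" if "x \<in> insert s X" for x
  proof -
    have "x \<in> Z" using that s X by auto
    then show ?thesis unfolding w'_def d2_diff using d2_d3[OF fin u] dw[OF that] by simp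
  qed
  have w'0: "w' x y = 0" if "x \<in> X" "y \<in> X" for x y using wu[OF that] by (simp add: w'_def)
  have sx: "w' s x \<in> faces (Z - insert s X) (Z - {s, x})" if x: "x \<in> X" for x
  proof -
    have xZ: "x \<in> Z" using x X by auto
    have eq: "Z - {x} - {s} = Z - {s, x}" by blast
    have "L (Z - {x} - {s}) (Z - {x}) (w' s x) \<in> faces (Z - insert s X) (Z - {x})"
      using cycle_in_K[OF fin s X w' _ x] w'0[OF x] dw'[of x] x by simp
    then show ?thesis
      using K[OF x] alt2D(3)[OF w' s(1) xZ] unfolding K_zero_def eq by blast
  qed
  \<comment> \<open>Entries of \<open>w'\<close> between points of \<open>X\<close> are zero and
    those involving \<open>s\<close> are faces, so what is left of the cycle is zero modulo
    faces.\<close>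
  have "\<exists>u'. alt3 Z u' \<and> (\<forall>x\<in>insert s X. \<forall>y\<in>insert s X. w' x y = d3 Z u' x y)"
  proof (rule H2_zero_if_faces[OF fin _ w'])
    show "insert s X \<subseteq> Z" using s X by auto
    fix x y assume xy: "x \<in> insert s X" "y \<in> insert s X" "x \<noteq> y"
    then have xyZ: "x \<in> Z" "y \<in> Z" using s X by auto
    show "w' x y \<in> faces (Z - insert s X) (Z - {x, y})"
    proof (cases "x = s")
      case True then show ?thesis using xy sx by auto
    next
      case False
      show ?thesis
      proof (cases "y = s")
        case True
        have "w' x y = - w' s x" using alt2D(2)[OF w' xyZ] True by simp
        moreover have "{x, y} = {s, x}" using True by auto
        ultimately show ?thesis using sx[of x] xy False by (auto intro: faces_neg)
      next
        case F: False
        then show ?thesis using xy False w'0 by simp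
      qed
    qed
  qed
  then obtain u' where u': "alt3 Z u'"
    "\<And>x y. \<lbrakk>x \<in> insert s X; y \<in> insert s X\<rbrakk> \<Longrightarrow> w' x y = d3 Z u' x y" by blast
  have "w x y = d3 Z (\<lambda>x y z. u x y z + u' x y z) x y" if "x \<in> insert s X" "y \<in> insert s X" for x y
    using u'(2)[OF that] unfolding d3_add w'_def by (simp add: algebra_simps)
  then show "\<exists>u. alt3 Z u \<and> (\<forall>x\<in>insert s X. \<forall>y\<in>insert s X. w x y = d3 Z u x y)"
    using alt3_add[OF u u'(1)] by blast
qed

end

section \<open>Dimensions\<close>

text \<open>The quotient of consecutive binomials in \<open>j\<close> is linear in \<open>n\<close>.
  Truncated subtraction does no harm: for \<open>n < j\<close> the factor \<open>n choose j\<close>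
  is zero.\<close>

lemma choose_poly:
  "\<exists>p :: rat poly. \<forall>n. of_nat (n choose j) = poly p (of_nat n)"
proof (induction j)
  case 0
  then show ?case by (intro exI[of _ 1]) simp
next
  case (Suc j)
  then obtain p :: "rat poly" where p: "\<And>n. of_nat (n choose j) = poly p (of_nat n)" by blast
  have "rat_of_nat (n choose Suc j) = poly (smult (1 / of_nat (Suc j)) (p * [:- of_nat j, 1:])) (of_nat n)" for n
  proof -
    have "Suc j * (n choose Suc j) = (n choose j) * (n - j)"
      by (metis Suc_times_binomial_eq binomial_absorb_comp mult.commute binomial_absorption)
    then have "rat_of_nat (Suc j) * of_nat (n choose Suc j) = of_nat (n choose j) * of_nat (n - j)"
      by (metis of_nat_mult)
    also have "\<dots> = of_nat (n choose j) * (of_nat n - of_nat j)"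
      by (cases "j \<le> n") (simp_all add: of_nat_diff)
    finally show ?thesis by (simp add: p[symmetric] field_simps del: of_nat_Suc)
  qed
  then show ?case by blast
qed

context vector_space
begin

text \<open>Rank-nullity for the map induced by \<open>f\<close> from \<open>A\<close> to the
  ambient space modulo \<open>C\<close>, without forming the quotient. A basis of the kernel extends
  to \<open>A\<close>, and the images of the added vectors complete a basis of \<open>C\<close> to
  one of the sum.\<close>

lemma dim_add_image:
  assumes f: "module_hom scale scale f" and A: "subspace A" and C: "subspace C"
    and fin: "finite T" "A \<subseteq> span T" "finite T'" "C \<subseteq> span T'"
  shows "dim {f v + c |v c. v \<in> A \<and> c \<in> C} + dim {v \<in> A. f v \<in> C} = dim A + dim C"
proof -
  define N where "N = {v \<in> A. f v \<in> C}"
  have N: "subspace N"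
    unfolding N_def using subspace_inter[OF A module_hom.subspace_linear_preimage[OF f C]]
    by (simp add: Int_def)
  obtain BN where BN: "BN \<subseteq> N" "independent BN" "N \<subseteq> span BN"
    using maximal_independent_subset by blast
  have NA: "N \<subseteq> A" by (auto simp: N_def)
  obtain BA where BA: "BN \<subseteq> BA" "BA \<subseteq> A" "independent BA" "A \<subseteq> span BA"
    using maximal_independent_subset_extend[of BN A] BN NA by blast
  obtain BC where BC: "BC \<subseteq> C" "independent BC" "C \<subseteq> span BC"
    using maximal_independent_subset by blast
  have fBA: "finite BA" using independent_span_bound[OF fin(1) BA(3)] BA(2) fin(2) by auto
  have fBC: "finite BC" using independent_span_bound[OF fin(3) BC(2)] BC(1) fin(4) by auto
  have spanBN: "span BN = N" using BN N by (metis span_subspace)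
  have spanBC: "span BC = C" using BC C by (metis span_subspace)
  have spanBA: "span BA = A" using BA A by (metis span_subspace)
  have img: "span (f ` B) = f ` span B" for B by (rule module_hom.span_image[OF f])
  have ind: "independent (BC \<union> f ` B) \<and> card (BC \<union> f ` B) = card BC + card B"
    if "finite B" "B \<subseteq> BA - BN" for B
    using that
  proof (induction B rule: finite_induct)
    case empty
    then show ?case using BC by simp
  next
    case (insert b B)
    \<comment> \<open>A dependence would put \<open>b - v\<close> into the kernel for some
      \<open>v\<close> in the span of the earlier vectors, and so \<open>b\<close> into the span of
      the other elements of \<open>BA\<close>.\<close>
    have "f b \<notin> span (BC \<union> f ` B)"
    proof
      assume "f b \<in> span (BC \<union> f ` B)"
      then obtain c v where c: "c \<in> C" and v: "v \<in> span B" and eq: "f b = c + f v"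
        unfolding span_Un img spanBC by auto
      have "span B \<subseteq> A" using insert.prems span_mono[of B BA] spanBA by auto
      then have "b - v \<in> A" using v insert.prems BA A by (auto intro: subspace_diff)
      then have "b - v \<in> span BN"
        unfolding spanBN N_def using c eq by (simp add: module_hom.diff[OF f])
      then have "b - v \<in> span (BN \<union> B)" "v \<in> span (BN \<union> B)"
        using v span_mono[of BN "BN \<union> B"] span_mono[of B "BN \<union> B"] by blast+
      then have "(b - v) + v \<in> span (BN \<union> B)" by (rule span_add)
      moreover have "BN \<union> B \<subseteq> BA - {b}" using insert BA by auto
      ultimately have "b \<in> span (BA - {b})" using span_mono[of "BN \<union> B" "BA - {b}"] by auto
      moreover have "b \<in> BA" using insert.prems by simp
      ultimately have "dependent BA" unfolding dependent_def by (rule bexI)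
      then show False using BA(3) by contradiction
    qed
    moreover from this have "f b \<notin> BC \<union> f ` B" using span_superset[of "BC \<union> f ` B"] by auto
    moreover have "independent (BC \<union> f ` B)" "card (BC \<union> f ` B) = card BC + card B"
      using insert.IH insert.prems by simp_all
    ultimately show ?case using insert.hyps fBC by (simp add: independent_insertI)
  qed
  define B where "B = BA - BN"
  have finB: "finite B" using fBA by (simp add: B_def)
  have "span (BC \<union> f ` B) = {f v + c |v c. v \<in> A \<and> c \<in> C}"
  proof (intro subset_antisym subsetI)
    fix x assume "x \<in> span (BC \<union> f ` B)"
    then obtain c v where c: "c \<in> C" and v: "v \<in> span B" and eq: "x = c + f v"
      unfolding span_Un img spanBC by auto
    have "v \<in> A" using v span_mono[of B BA] spanBA by (auto simp: B_def)
    then show "x \<in> {f v + c |v c. v \<in> A \<and> c \<in> C}" using c eq by (auto simp: add.commute)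
  next
    fix x assume "x \<in> {f v + c |v c. v \<in> A \<and> c \<in> C}"
    then obtain c v where c: "c \<in> C" and v: "v \<in> A" and eq: "x = f v + c" by auto
    have "BN \<union> B = BA" using BA by (auto simp: B_def)
    then have "v \<in> span (BN \<union> B)" using v spanBA by simp
    then obtain p q where p: "p \<in> N" and q: "q \<in> span B" and vpq: "v = p + q"
      unfolding span_Un spanBN by auto
    have "x = (f p + c) + f q" by (simp add: eq vpq module_hom.add[OF f] algebra_simps)
    moreover have "f p + c \<in> span BC" unfolding spanBC using p c C by (auto simp: N_def intro: subspace_add)
    ultimately show "x \<in> span (BC \<union> f ` B)" unfolding span_Un img using q by blast
  qed
  then have "dim {f v + c |v c. v \<in> A \<and> c \<in> C} = card BC + card B"
    using ind[OF finB] dim_span_eq_card_independent[of "BC \<union> f ` B"] by (simp add: B_def)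
  moreover have "dim A = card BA" using dim_span_eq_card_independent[OF BA(3)] spanBA by simp
  moreover have "dim C = card BC" using dim_span_eq_card_independent[OF BC(2)] spanBC by simp
  moreover have "dim N = card BN" using dim_span_eq_card_independent[OF BN(2)] spanBN by simp
  moreover have "card BA = card BN + card B"
    using fBA BA(1) by (metis B_def card_Diff_subset card_mono finite_subset le_add_diff_inverse)
  ultimately show ?thesis unfolding N_def by simp
qed

lemma dim_zero_space: "dim {0} = 0"
  using dim_span_eq_card_independent[OF independent_empty] by simp

lemma dim_injective_image:
  assumes f: "module_hom scale scale f" and A: "subspace A" and fin: "finite T" "A \<subseteq> span T"
    and inj: "inj_on f A"
  shows "dim (f ` A) = dim A"
proof -
  have "0 \<in> A" using A by (rule subspace_0)
  then have "{v \<in> A. f v \<in> {0}} = {0}"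
    using inj_onD[OF inj, of _ 0] module_hom.zero[OF f] by auto
  moreover have "{f v + c |v c. v \<in> A \<and> c \<in> {0}} = f ` A" by auto
  ultimately show ?thesis using dim_add_image[OF f A subspace_single_0 fin, of "{}"] by (simp add: dim_zero_space)
qed

end

text \<open>\<open>D\<close> and \<open>R\<close> are one more than the generation degree \<open>d\<close> and the relation degree \<open>r\<close>
  (and \<open>0\<close> if these are \<open>-\<infinity>\<close>); the condition on \<open>t\<close> amounts to \<open>r + min r d \<le> t\<close>.\<close>
locale presented_fi_functor = fi_functor scale W M
  for scale :: "'k::field \<Rightarrow> 'v::ab_group_add \<Rightarrow> 'v" and W M +
  fixes D R t :: nat
  assumes generated: "\<lbrakk>finite Z; D \<le> card Z\<rbrakk> \<Longrightarrow> W Z \<subseteq> faces Z Z"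
    and related: "\<lbrakk>finite Z; R \<le> card Z\<rbrakk> \<Longrightarrow> H1_zero Z"
    and threshold: "\<lbrakk>a < D; a + 1 < R\<rbrakk> \<Longrightarrow> R + a \<le> t + 1"
    and finite_dim: "\<exists>T. finite T \<and> W X \<subseteq> span T"
begin

section \<open>Vanishing ranges by descending induction\<close>

text \<open>Induction on \<open>card Z\<close>: the part of \<open>v\<close> coming from
  \<open>W (Z - {z})\<close> is a face when \<open>z\<close> lies in \<open>E\<close>, and otherwise
  comes from a smaller set that still contains \<open>E\<close>. Hence the \<open>a\<close>-fold
  iterated cokernel is zero as soon as \<open>D \<le> a\<close>.\<close>

lemma faces_all:
  assumes "finite Z" "E \<subseteq> Z" "D \<le> card E"
  shows "W Z \<subseteq> faces E Z"
  using assms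
proof (induction "card Z" arbitrary: Z rule: less_induct)
  case less
  show ?case
  proof
    fix v assume v: "v \<in> W Z"
    have "D \<le> card Z" using less.prems card_mono[of Z E] by linarith
    then have "v \<in> faces Z Z" using generated less.prems v by blast
    then obtain b where b: "\<And>z. z \<in> Z \<Longrightarrow> b z \<in> W (Z - {z})" "v = (\<Sum>z\<in>Z. L (Z - {z}) Z (b z))"
      by (elim facesE) blast
    have "L (Z - {z}) Z (b z) \<in> faces E Z" if z: "z \<in> Z" for z
    proof (cases "z \<in> E")
      case True
      then show ?thesis using less.prems b(1)[OF z] by (intro faces_one) (auto intro: finite_subset)
    next
      case False
      then have E: "E \<subseteq> Z - {z}" using less.prems by auto
      have "card (Z - {z}) < card Z" using z less.prems by (metis card_Diff1_less)
      then have "W (Z - {z}) \<subseteq> faces E (Z - {z})" using less.hyps E less.prems by simp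
      then show ?thesis using b(1)[OF z] E less.prems by (intro L_faces) auto
    qed
    then show "v \<in> faces E Z" unfolding b(2) by (rule faces_sum)
  qed
qed

text \<open>Each passage to the cokernel lowers the generation and relation degrees by one, so
  \<open>t\<close> drops to \<open>t - 2 * a\<close>, to be compared with the degree
  \<open>card (Z - E) - 1\<close> of the kernel. The premise \<open>H2\<close> is conditional so
  that it can be met both inside the induction for \<open>H2_vanishing\<close> and after it.\<close>

lemma K_zero_if_H2_zero:
  assumes h: "finite Z" "s \<in> Z" "E \<subseteq> Z - {s}" "card E = a"
      "D \<le> a \<or> R \<le> a + 1 \<or> t + 1 \<le> card (Z - E) + 2 * a"
    and H2: "\<lbrakk>D \<le> a + 1 \<or> R \<le> a + 2 \<or> t + 2 \<le> card (Z - insert s E) + 2 * (a + 1)\<rbrakk>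
      \<Longrightarrow> H2_zero Z (Z - insert s E)"
  shows "K_zero E Z s"
proof (cases "D \<le> a")
  case True
  then show ?thesis using faces_all[of "Z - {s}" E] h unfolding K_zero_def by auto
next
  case False
  define X where "X = Z - insert s E"
  have finE: "finite E" and EZ: "E \<subseteq> Z" using h by (auto intro: finite_subset)
  have ZX: "Z - insert s X = E" "Z - E = insert s X" using h by (auto simp: X_def)
  have "finite X" "s \<notin> X" using h by (auto simp: X_def)
  then have cZ: "card (Z - E) = card X + 1" unfolding ZX(2) by simp
  have "card Z = card X + 1 + a"
    using card_Diff_subset[OF finE EZ] card_mono[OF h(1) EZ] h(4) cZ by linarith
  \<comment> \<open>If \<open>a + 1 < R\<close>, then \<open>threshold\<close> bounds
    \<open>R\<close> by \<open>t + 1 - a\<close>, which is at most \<open>card X + 1 + a\<close>. If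
    \<open>R \<le> a + 1\<close>, the points of \<open>E\<close> together with \<open>s\<close> are
    already enough.\<close>
  then have "R \<le> card Z" using h(5) threshold[of a] False cZ by linarith
  then have "H1_zero Z" by (rule related[OF h(1)])
  moreover have "H2_zero Z X" unfolding X_def
  proof (rule H2)
    show "D \<le> a + 1 \<or> R \<le> a + 2 \<or> t + 2 \<le> card (Z - insert s E) + 2 * (a + 1)"
      using h(5) False cZ unfolding X_def[symmetric] by auto
  qed
  moreover have "s \<notin> X" "X \<subseteq> Z" by (auto simp: X_def)
  ultimately show ?thesis using K_zero_step[of Z s X] h(1,2) unfolding ZX(1) by blast
qed

text \<open>Descending induction on \<open>a\<close>, where \<open>k\<close> bounds the distance to
  \<open>D\<close>, at which the cokernel is zero. The step uses the next cokernel on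
  \<open>Y - {s}\<close>, and on \<open>Y - {s, x}\<close> to control kernels, so \<open>Z\<close>
  and \<open>Y\<close> must vary. Kernels enter on sets with two points fewer than \<open>Y\<close>,
  which accounts for the \<open>2\<close> in \<open>t + 2\<close>.\<close>

lemma H2_vanishing:
  assumes "D \<le> a + k" "finite Z" "Y \<subseteq> Z" "card (Z - Y) = a"
    "D \<le> a \<or> R \<le> a + 1 \<or> t + 2 \<le> card Y + 2 * a"
  shows "H2_zero Z Y"
  using assms
proof (induction k arbitrary: a Z Y)
  case 0
  show ?case unfolding H2_zero_def
  proof (intro allI impI)
    fix w assume w: "alt2 Z w \<and> (\<forall>x\<in>Y. d2 Z w x = 0)"
    show "\<exists>u. alt3 Z u \<and> (\<forall>x\<in>Y. \<forall>y\<in>Y. w x y = d3 Z u x y)"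
    proof (rule H2_zero_if_faces)
      fix x y assume xy: "x \<in> Y" "y \<in> Y" "x \<noteq> y"
      have "w x y \<in> W (Z - {x, y})" using alt2D(3)[of Z w x y] w xy 0 by blast
      then show "w x y \<in> faces (Z - Y) (Z - {x, y})"
        using faces_all[of "Z - {x, y}" "Z - Y"] xy 0 by auto
    qed (use 0 w in auto)
  qed
next
  case (Suc k)
  show ?case
  proof (cases "Y = {}")
    case True
    have "alt3 Z (\<lambda>_ _ _. 0)" by (simp add: alt3_def)
    then show ?thesis using True unfolding H2_zero_def by auto
  next
    case False
    then obtain s where s: "s \<in> Y" by blast
    define X where "X = Y - {s}"
    have finY: "finite Y" using Suc.prems by (auto intro: finite_subset)
    have ZX: "Z - X = insert s (Z - Y)" "insert s X = Y" using Suc.prems s by (auto simp: X_def)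
    have cX: "card (Z - X) = a + 1" using Suc.prems s by (subst ZX) auto
    have cY: "card Y = card X + 1" using s finY unfolding X_def by (metis Suc_eq_plus1 card.remove)
    have XZ: "X \<subseteq> Z" using Suc.prems by (auto simp: X_def)
    have "H2_zero Z X" using Suc.IH[of "a + 1" Z X] Suc.prems cX cY XZ by auto
    moreover have "K_zero (Z - insert s X) (Z - {x}) s" if x: "x \<in> X" for x
      unfolding ZX(2)
    proof (rule K_zero_if_H2_zero)
      have eq: "Z - {x} - (Z - Y) = Y - {x}" "Z - {x} - insert s (Z - Y) = X - {x}"
        "Z - {x} - (X - {x}) = insert s (Z - Y)"
        using s x Suc.prems by (auto simp: X_def)
      have c: "card Y = card (Y - {x}) + 1" "card X = card (X - {x}) + 1"
        using x finY unfolding X_def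
        by (metis DiffD1 Suc_eq_plus1 card.remove, metis Suc_eq_plus1 card.remove finite_Diff)
      show "D \<le> a \<or> R \<le> a + 1 \<or> t + 1 \<le> card (Z - {x} - (Z - Y)) + 2 * a"
        unfolding eq using Suc.prems c by auto
      assume "D \<le> a + 1 \<or> R \<le> a + 2 \<or> t + 2 \<le> card (Z - {x} - insert s (Z - Y)) + 2 * (a + 1)"
      then have "D \<le> a + 1 \<or> R \<le> a + 1 + 1 \<or> t + 2 \<le> card (X - {x}) + 2 * (a + 1)"
        unfolding eq by simp
      moreover have "card (Z - {x} - (X - {x})) = a + 1" using cX unfolding eq ZX .
      moreover have "X - {x} \<subseteq> Z - {x}" using XZ by auto
      ultimately show "H2_zero (Z - {x}) (Z - {x} - insert s (Z - Y))"
        unfolding eq(2) using Suc.prems(1,2) by (intro Suc.IH[of "a + 1"]) auto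
    qed (use Suc.prems s x in \<open>auto simp: X_def\<close>)
    ultimately show ?thesis using H2_zero_step[of Z s X] Suc.prems s ZX by (auto simp: X_def)
  qed
qed

lemma K_vanishing:
  assumes h: "finite Z" "s \<in> Z" "E \<subseteq> Z - {s}" "card E = a"
      "D \<le> a \<or> R \<le> a + 1 \<or> t + 1 \<le> card (Z - E) + 2 * a"
  shows "K_zero E Z s"
proof (rule K_zero_if_H2_zero[OF h])
  assume *: "D \<le> a + 1 \<or> R \<le> a + 2 \<or> t + 2 \<le> card (Z - insert s E) + 2 * (a + 1)"
  have "finite E" "s \<notin> E" "Z - (Z - insert s E) = insert s E" using h by (auto intro: finite_subset)
  then show "H2_zero Z (Z - insert s E)"
    using h * by (intro H2_vanishing[of "a + 1" D]) auto
qed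

section \<open>Dimension counts for iterated cokernels\<close>

text \<open>The dimension of \<open>W Z\<close> modulo \<open>faces E Z\<close> for
  \<open>E \<subseteq> Z\<close>; integers avoid truncated subtraction.\<close>

definition defect :: "nat set \<Rightarrow> nat set \<Rightarrow> int" where
  "defect E Z = int (dim (W Z)) - int (dim (faces E Z))"

lemma defect_all: "\<lbrakk>finite Z; E \<subseteq> Z; D \<le> card E\<rbrakk> \<Longrightarrow> defect E Z = 0"
  using faces_all faces_subset unfolding defect_def by (metis diff_self subset_antisym)

text \<open>With zero kernel, the values at \<open>Z - insert s E\<close> and at
  \<open>Z - E\<close> and the next cokernel form a short exact sequence. The count is
  \<open>dim_add_image\<close> for the inclusion of \<open>Z - {s}\<close>, taken modulo
  \<open>faces E Z\<close>.\<close>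

lemma defect_step:
  assumes fin: "finite Z" and s: "s \<in> Z" and E: "E \<subseteq> Z - {s}" and K: "K_zero E Z s"
  shows "defect E Z = defect E (Z - {s}) + defect (insert s E) Z"
proof -
  have EZ: "E \<subseteq> Z" using E by auto
  have finE: "finite E" using EZ fin by (rule finite_subset)
  have sE: "s \<notin> E" using E by auto
  have sub: "faces E (Z - {s}) \<subseteq> W (Z - {s})" using E fin by (intro faces_subset) auto
  obtain T where T: "finite T" "W (Z - {s}) \<subseteq> span T" using finite_dim by blast
  obtain T' where T': "finite T'" "faces E Z \<subseteq> span T'"
    using finite_dim[of Z] faces_subset[OF fin EZ] by blast
  have "{L (Z - {s}) Z v + c |v c. v \<in> W (Z - {s}) \<and> c \<in> faces E Z} = faces (insert s E) Z"
  proof (intro subset_antisym subsetI)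
    fix x assume "x \<in> {L (Z - {s}) Z v + c |v c. v \<in> W (Z - {s}) \<and> c \<in> faces E Z}"
    then obtain v c where v: "v \<in> W (Z - {s})" and c: "c \<in> faces E Z" and x: "x = L (Z - {s}) Z v + c"
      by blast
    obtain b where b: "\<And>e. e \<in> E \<Longrightarrow> b e \<in> W (Z - {e})" "c = (\<Sum>e\<in>E. L (Z - {e}) Z (b e))"
      using c by (elim facesE) blast
    have "c \<in> faces (insert s E) Z"
      unfolding b(2) using finE b(1) by (intro faces_sum faces_one) auto
    moreover have "L (Z - {s}) Z v \<in> faces (insert s E) Z" using finE v by (intro faces_one) auto
    ultimately show "x \<in> faces (insert s E) Z" unfolding x by (intro faces_add)
  next
    fix x assume "x \<in> faces (insert s E) Z"
    then obtain b where b: "\<And>e. e \<in> insert s E \<Longrightarrow> b e \<in> W (Z - {e})"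
      "x = (\<Sum>e\<in>insert s E. L (Z - {e}) Z (b e))" by (elim facesE) blast
    have "x = L (Z - {s}) Z (b s) + (\<Sum>e\<in>E. L (Z - {e}) Z (b e))" unfolding b(2) using finE sE by simp
    then show "x \<in> {L (Z - {s}) Z v + c |v c. v \<in> W (Z - {s}) \<and> c \<in> faces E Z}"
      using b(1) facesI[of E b Z] by blast
  qed
  moreover have "{v \<in> W (Z - {s}). L (Z - {s}) Z v \<in> faces E Z} = faces E (Z - {s})"
    using K sub L_faces[OF fin E] unfolding K_zero_def by blast
  ultimately have "dim (faces (insert s E) Z) + dim (faces E (Z - {s})) = dim (W (Z - {s})) + dim (faces E Z)"
    using dim_add_image[OF M_linear W_subspace faces_subspace T T', of "Z - {s}" Z id] by simp
  then show ?thesis unfolding defect_def by linarith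
qed

text \<open>The action of the inverse bijection inverts \<open>M Z Z' f\<close>, and both maps
  respect faces.\<close>

lemma defect_eq_if_bij:
  assumes fin: "finite Z" and f: "bij_betw f Z Z'" and E: "E \<subseteq> Z"
  shows "defect E Z = defect (f ` E) Z'"
proof -
  define g where "g = inv_into Z f"
  have i: "inj_on f Z" "f ` Z \<subseteq> Z'" and Z': "finite Z'" "f ` Z = Z'"
    using f fin by (auto simp: bij_betw_def)
  have g: "inj_on g Z'" "g ` Z' \<subseteq> Z" using bij_betw_inv_into[OF f] by (auto simp: bij_betw_def g_def)
  have gf: "g (f x) = x" if "x \<in> Z" for x using that i by (simp add: g_def)
  have fg: "f (g x) = x" if "x \<in> Z'" for x using that Z' by (simp add: g_def f_inv_into_f)
  have GF: "M Z' Z g (M Z Z' f v) = v" if "v \<in> W Z" for v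
  proof -
    have "M Z' Z g (M Z Z' f v) = M Z Z (g \<circ> f) v" using fin Z' i g that by (intro M_comp) auto
    also have "\<dots> = M Z Z id v" using fin i g that gf
      by (intro M_cong) (auto intro: comp_inj_on inj_on_subset)
    finally show ?thesis using M_id fin that by simp
  qed
  have FG: "M Z Z' f (M Z' Z g v) = v" if "v \<in> W Z'" for v
  proof -
    have "M Z Z' f (M Z' Z g v) = M Z' Z' (f \<circ> g) v" using fin Z' i g that by (intro M_comp) auto
    also have "\<dots> = M Z' Z' id v" using Z' i g that fg
      by (intro M_cong) (auto intro: comp_inj_on inj_on_subset)
    finally show ?thesis using M_id Z' that by simp
  qed
  have inj: "inj_on (M Z Z' f) (W Z)" using GF by (metis inj_onI)
  obtain T where T: "finite T" "W Z \<subseteq> span T" using finite_dim by blast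
  have sub: "faces E Z \<subseteq> W Z" using faces_subset fin E by blast
  have sub': "faces (f ` E) Z' \<subseteq> W Z'" using E Z' by (intro faces_subset) auto
  have "M Z Z' f ` W Z = W Z'"
  proof
    show "M Z Z' f ` W Z \<subseteq> W Z'" using M_in fin Z' i by blast
    show "W Z' \<subseteq> M Z Z' f ` W Z" using FG M_in[OF Z'(1) fin g] by (metis image_eqI subsetI)
  qed
  moreover have "M Z Z' f ` faces E Z = faces (f ` E) Z'"
  proof
    show "M Z Z' f ` faces E Z \<subseteq> faces (f ` E) Z'" using M_faces fin Z' i E by blast
    have "g ` f ` E = E" unfolding image_image using gf E by (simp add: subset_iff)
    moreover have "f ` E \<subseteq> Z'" using E i by auto
    ultimately have "M Z' Z g v \<in> faces E Z" if "v \<in> faces (f ` E) Z'" for v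
      using M_faces[OF Z'(1) fin g _ that] by simp
    then show "faces (f ` E) Z' \<subseteq> M Z Z' f ` faces E Z" using FG sub'
      by (intro subsetI image_eqI[OF sym]) auto
  qed
  moreover have "dim (M Z Z' f ` W Z) = dim (W Z)"
    by (rule dim_injective_image[OF M_linear W_subspace T inj])
  moreover have "dim (M Z Z' f ` faces E Z) = dim (faces E Z)"
    by (rule dim_injective_image[OF M_linear faces_subspace T(1)]) (use T sub inj in \<open>auto intro: inj_on_subset\<close>)
  ultimately show ?thesis unfolding defect_def by simp
qed

lemma defect_eq_if_card:
  assumes "finite Z" "finite Z'" "E \<subseteq> Z" "E' \<subseteq> Z'" "card E = card E'" "card (Z - E) = card (Z' - E')"
  shows "defect E Z = defect E' Z'"
proof -
  have "finite E" "finite E'" using assms by (auto intro: finite_subset)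
  then obtain f where f: "bij_betw f E E'" using assms by (meson finite_same_card_bij)
  obtain g where g: "bij_betw g (Z - E) (Z' - E')" using assms by (meson finite_Diff finite_same_card_bij)
  define h where "h x = (if x \<in> E then f x else g x)" for x
  have hE: "bij_betw h E E'" using f by (rule bij_betw_cong[THEN iffD1, rotated]) (simp add: h_def)
  have "bij_betw h (Z - E) (Z' - E')" using g by (rule bij_betw_cong[THEN iffD1, rotated]) (simp add: h_def)
  with hE have "bij_betw h (E \<union> (Z - E)) (E' \<union> (Z' - E'))" by (rule bij_betw_combine) auto
  moreover have "E \<union> (Z - E) = Z" "E' \<union> (Z' - E') = Z'" using assms by auto
  ultimately show ?thesis using defect_eq_if_bij[of Z h Z' E] assms hE by (simp add: bij_betw_def)
qed

text \<open>Descending induction on \<open>a\<close>: by \<open>defect_step\<close> the first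
  difference in \<open>card (Z - E)\<close> is the next defect, a combination of binomials
  \<open>n choose j\<close>. By Pascal's rule, summation turns each into
  \<open>n choose Suc j\<close> and adds a constant.\<close>

lemma defect_binomial:
  assumes "D \<le> a + k"
  shows "\<exists>J (c :: nat \<Rightarrow> rat). \<forall>E Z. finite Z \<and> E \<subseteq> Z \<and> card E = a \<and>
      (D \<le> a \<or> R \<le> a + 1 \<or> t \<le> card (Z - E) + 2 * a) \<longrightarrow>
      of_int (defect E Z) = (\<Sum>j<J. c j * of_nat (card (Z - E) choose j))"
  using assms
proof (induction k arbitrary: a)
  case 0
  then show ?case using defect_all by (intro exI[of _ 0]) auto
next
  case (Suc k)
  obtain J and c :: "nat \<Rightarrow> rat" where IH: "\<And>E Z. \<lbrakk>finite Z; E \<subseteq> Z; card E = a + 1;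
      D \<le> a + 1 \<or> R \<le> a + 2 \<or> t \<le> card (Z - E) + 2 * (a + 1)\<rbrakk> \<Longrightarrow>
      of_int (defect E Z) = (\<Sum>j<J. c j * of_nat (card (Z - E) choose j))"
    using Suc.IH[of "a + 1"] Suc.prems by auto
  \<comment> \<open>The degree from which \<open>K_vanishing\<close> applies to the
    \<open>a\<close>-fold cokernel; it is \<open>0\<close> when one of the first two alternatives
    covers every degree.\<close>
  define N where "N = (if D \<le> a \<or> R \<le> a + 1 then 0 else t - 2 * a)"
  define q where "q n = rat_of_int (defect {..<a} {..<a + n})" for n
  have step: "q (Suc n) = q n + (\<Sum>j<J. c j * of_nat (n choose j))" if n: "N \<le> n" for n
  proof -
    define Z where "Z = {..<a + Suc n}"
    have ZE: "Z - {..<a} = {a..<a + Suc n}" "Z - insert (a + n) {..<a} = {a..<a + n}"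
      and Zs: "Z - {a + n} = {..<a + n}" by (auto simp: Z_def)
    have cond: "D \<le> a \<or> R \<le> a + 1 \<or> t \<le> n + 2 * a" using n by (auto simp: N_def split: if_splits)
    have Z: "finite Z" "a + n \<in> Z" "{..<a} \<subseteq> Z - {a + n}" "card (Z - {..<a}) = n + 1"
      "insert (a + n) {..<a} \<subseteq> Z" "card (Z - insert (a + n) {..<a}) = n"
      unfolding ZE by (auto simp: Z_def)
    have "D \<le> a \<or> R \<le> a + 1 \<or> t + 1 \<le> card (Z - {..<a}) + 2 * a" unfolding Z(4) using cond by linarith
    then have "K_zero {..<a} Z (a + n)"
      using K_vanishing[OF Z(1-3)] by simp
    then have "defect {..<a} Z = defect {..<a} {..<a + n} + defect (insert (a + n) {..<a}) Z"
      using defect_step[OF Z(1-3)] Zs by simp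
    moreover have "of_int (defect (insert (a + n) {..<a}) Z) = (\<Sum>j<J. c j * of_nat (n choose j))"
      using IH[OF Z(1,5)] cond Z(6) by auto
    ultimately show ?thesis by (simp add: q_def Z_def)
  qed
  \<comment> \<open>The constant of summation, fixed by the value at \<open>N\<close>.\<close>
  define C where "C = q N - (\<Sum>j<J. c j * of_nat (N choose Suc j))"
  have q: "q n = C + (\<Sum>j<J. c j * of_nat (n choose Suc j))" if "N \<le> n" for n
    using that
  proof (induction n rule: dec_induct)
    case base
    then show ?case by (simp add: C_def)
  next
    case (step n)
    then show ?case using \<open>N \<le> n \<Longrightarrow> q (Suc n) = _\<close> by (simp add: algebra_simps sum.distrib)
  qed
  define c' where "c' j = (case j of 0 \<Rightarrow> C | Suc i \<Rightarrow> c i)" for j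
  have q': "q n = (\<Sum>j<Suc J. c' j * of_nat (n choose j))" if "N \<le> n" for n
    unfolding q[OF that] by (subst sum.lessThan_Suc_shift) (simp add: c'_def)
  show ?case
  proof (intro exI allI impI)
    fix E Z :: "nat set"
    assume h: "finite Z \<and> E \<subseteq> Z \<and> card E = a \<and> (D \<le> a \<or> R \<le> a + 1 \<or> t \<le> card (Z - E) + 2 * a)"
    define n where "n = card (Z - E)"
    have "{..<a + n} - {..<a} = {a..<a + n}" by auto
    then have "defect E Z = defect {..<a} {..<a + n}"
      using h by (intro defect_eq_if_card) (auto simp: n_def)
    moreover have "N \<le> n" using h by (auto simp: N_def n_def)
    ultimately show "of_int (defect E Z) = (\<Sum>j<Suc J. c' j * of_nat (card (Z - E) choose j))"
      using q'[of n] by (simp add: q_def n_def)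
  qed
qed

theorem dim_polynomial:
  "\<exists>P :: rat poly. \<forall>Z. finite Z \<and> (D = 0 \<or> R \<le> 1 \<or> t \<le> card Z)
     \<longrightarrow> of_nat (dim (W Z)) = poly P (of_nat (card Z))"
proof -
  obtain J and c :: "nat \<Rightarrow> rat" where J: "\<And>E Z. \<lbrakk>finite Z; E \<subseteq> Z; card E = 0;
      D \<le> 0 \<or> R \<le> 0 + 1 \<or> t \<le> card (Z - E) + 2 * 0\<rbrakk> \<Longrightarrow>
      of_int (defect E Z) = (\<Sum>j<J. c j * of_nat (card (Z - E) choose j))"
    using defect_binomial[of 0 D] by auto
  obtain p :: "nat \<Rightarrow> rat poly" where p: "\<And>j n. of_nat (n choose j) = poly (p j) (of_nat n)"
    using choose_poly by metis
  have "of_nat (dim (W Z)) = poly (\<Sum>j<J. smult (c j) (p j)) (of_nat (card Z))"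
    if "finite Z" "D = 0 \<or> R \<le> 1 \<or> t \<le> card Z" for Z
    using J[of Z "{}"] that by (auto simp: defect_def dim_zero_space poly_sum p)
  then show ?thesis by blast
qed

end

section \<open>From modules to functors on finite sets\<close>

text \<open>Any bijection serves: it need not be monotone, nor the identity on
  \<open>{1..n}\<close>.\<close>

definition enum :: "nat set \<Rightarrow> nat \<Rightarrow> nat" where
  "enum X = (SOME e. bij_betw e {1..card X} X)"

definition index :: "nat set \<Rightarrow> nat \<Rightarrow> nat" where
  "index X = inv_into {1..card X} (enum X)"

lemma enum_bij:
  assumes "finite X"
  shows "bij_betw (enum X) {1..card X} X"
  unfolding enum_def using assms by (intro someI_ex[of "\<lambda>e. bij_betw e {1..card X} X"] finite_same_card_bij) auto

lemma enum_in: "\<lbrakk>finite X; i \<in> {1..card X}\<rbrakk> \<Longrightarrow> enum X i \<in> X"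
  using enum_bij by (meson bij_betwE)

lemma index_bij: "finite X \<Longrightarrow> bij_betw (index X) X {1..card X}"
  unfolding index_def by (intro bij_betw_inv_into enum_bij)

lemma index_in: "\<lbrakk>finite X; x \<in> X\<rbrakk> \<Longrightarrow> index X x \<in> {1..card X}"
  using index_bij by (meson bij_betwE)

lemma index_enum: "\<lbrakk>finite X; i \<in> {1..card X}\<rbrakk> \<Longrightarrow> index X (enum X i) = i"
  unfolding index_def using enum_bij by (meson bij_betw_inv_into_left)

lemma enum_index: "\<lbrakk>finite X; x \<in> X\<rbrakk> \<Longrightarrow> enum X (index X x) = x"
  unfolding index_def using enum_bij by (meson bij_betw_inv_into_right)

text \<open>Labels are trivial here, so the functor on finite sets records only the action of plain
  injections. General labels are absorbed by \<open>set_mor_factor\<close>.\<close>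

definition set_mor :: "('g, 'b) monoid_scheme \<Rightarrow> nat set \<Rightarrow> nat set \<Rightarrow> (nat \<Rightarrow> nat) \<Rightarrow> 'g fimor" where
  "set_mor G X Y f = (restrict (\<lambda>i. index Y (f (enum X i))) {1..card X},
     restrict (\<lambda>_. \<one>\<^bsub>G\<^esub>) {1..card X})"

section \<open>Calculus of labelled injections\<close>

lemma homsD:
  assumes "\<phi> \<in> homs G n m"
  shows "fst \<phi> \<in> {1..n} \<rightarrow>\<^sub>E {1..m}" "inj_on (fst \<phi>) {1..n}" "snd \<phi> \<in> {1..n} \<rightarrow>\<^sub>E carrier G"
    "\<And>i. i \<in> {1..n} \<Longrightarrow> fst \<phi> i \<in> {1..m}" "\<And>i. i \<in> {1..n} \<Longrightarrow> snd \<phi> i \<in> carrier G"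
  using assms unfolding homs_def by auto

lemma homsI:
  assumes "fst \<phi> \<in> {1..n} \<rightarrow>\<^sub>E {1..m}" "inj_on (fst \<phi>) {1..n}" "snd \<phi> \<in> {1..n} \<rightarrow>\<^sub>E carrier G"
  shows "\<phi> \<in> homs G n m"
  using assms unfolding homs_def by (cases \<phi>) auto

lemma homs_eqI:
  assumes "\<phi> \<in> homs G n m" "\<psi> \<in> homs G n m"
    and "\<And>i. i \<in> {1..n} \<Longrightarrow> fst \<phi> i = fst \<psi> i \<and> snd \<phi> i = snd \<psi> i"
  shows "\<phi> = \<psi>"
proof (rule prod_eqI)
  show "fst \<phi> = fst \<psi>" by (rule PiE_ext[OF homsD(1)[OF assms(1)] homsD(1)[OF assms(2)]]) (use assms(3) in simp)
  show "snd \<phi> = snd \<psi>" by (rule PiE_ext[OF homsD(3)[OF assms(1)] homsD(3)[OF assms(2)]]) (use assms(3) in simp)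
qed

lemma finite_homs: "finite (carrier G) \<Longrightarrow> finite (homs G n m)"
  by (rule finite_subset[of _ "({1..n} \<rightarrow>\<^sub>E {1..m}) \<times> ({1..n} \<rightarrow>\<^sub>E carrier G)"])
     (auto simp: homs_def intro!: finite_PiE)

context group
begin

lemma fcomp_in:
  assumes "\<phi> \<in> homs G n m" "\<psi> \<in> homs G m l"
  shows "fcomp G n \<psi> \<phi> \<in> homs G n l"
proof (rule homsI)
  have "fst \<phi> ` {1..n} \<subseteq> {1..m}" using homsD(4)[OF assms(1)] by auto
  then have "inj_on (fst \<psi> \<circ> fst \<phi>) {1..n}"
    using homsD(2)[OF assms(1)] homsD(2)[OF assms(2)] by (blast intro: comp_inj_on inj_on_subset)
  then show "inj_on (fst (fcomp G n \<psi> \<phi>)) {1..n}"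
    unfolding fcomp_def fst_conv by (simp add: inj_on_restrict_eq)
  show "fst (fcomp G n \<psi> \<phi>) \<in> {1..n} \<rightarrow>\<^sub>E {1..l}"
    unfolding fcomp_def fst_conv using homsD(4)[OF assms(1)] homsD(4)[OF assms(2)]
    by (intro restrict_PiE_iff[THEN iffD2] ballI) simp
  show "snd (fcomp G n \<psi> \<phi>) \<in> {1..n} \<rightarrow>\<^sub>E carrier G"
    unfolding fcomp_def snd_conv using homsD(4,5)[OF assms(1)] homsD(5)[OF assms(2)]
    by (intro restrict_PiE_iff[THEN iffD2] ballI) simp
qed

lemma fcomp_assoc:
  assumes "\<phi> \<in> homs G n m" "\<psi> \<in> homs G m l" "\<chi> \<in> homs G l k"
  shows "fcomp G n \<chi> (fcomp G n \<psi> \<phi>) = fcomp G n (fcomp G m \<chi> \<psi>) \<phi>"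
proof (rule homs_eqI)
  show "fcomp G n \<chi> (fcomp G n \<psi> \<phi>) \<in> homs G n k" "fcomp G n (fcomp G m \<chi> \<psi>) \<phi> \<in> homs G n k"
    using assms by (blast intro: fcomp_in)+
  fix i assume i: "i \<in> {1..n}"
  have j: "fst \<phi> i \<in> {1..m}" "fst \<psi> (fst \<phi> i) \<in> {1..l}"
    using homsD(4)[OF assms(1) i] homsD(4)[OF assms(2)] by auto
  show "fst (fcomp G n \<chi> (fcomp G n \<psi> \<phi>)) i = fst (fcomp G n (fcomp G m \<chi> \<psi>) \<phi>) i \<and>
    snd (fcomp G n \<chi> (fcomp G n \<psi> \<phi>)) i = snd (fcomp G n (fcomp G m \<chi> \<psi>) \<phi>) i"
    unfolding fcomp_def fst_conv snd_conv restrict_apply' [OF i] comp_apply restrict_apply'[OF j(1)]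
    using homsD(5)[OF assms(1) i] homsD(5)[OF assms(2) j(1)] homsD(5)[OF assms(3) j(2)]
    by (simp add: m_assoc)
qed

lemma fid_in: "fid G n \<in> homs G n n"
  by (rule homsI) (auto simp: fid_def inj_on_def)

lemma fcomp_fid:
  assumes "\<phi> \<in> homs G n m"
  shows "fcomp G n (fid G m) \<phi> = \<phi>"
proof (rule homs_eqI[OF fcomp_in[OF assms fid_in] assms])
  fix i assume i: "i \<in> {1..n}"
  show "fst (fcomp G n (fid G m) \<phi>) i = fst \<phi> i \<and> snd (fcomp G n (fid G m) \<phi>) i = snd \<phi> i"
    using i homsD(4,5)[OF assms i] by (simp add: fcomp_def fid_def)
qed

text \<open>Positions cancel by injectivity, then labels by the group law. So morphisms are monic,
  which makes the structure maps of free modules injective.\<close>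

lemma fcomp_cancel:
  assumes "\<phi> \<in> homs G n m" "\<phi>' \<in> homs G n m" "\<psi> \<in> homs G m l"
    and eq: "fcomp G n \<psi> \<phi> = fcomp G n \<psi> \<phi>'"
  shows "\<phi> = \<phi>'"
proof (rule homs_eqI[OF assms(1,2)])
  fix i assume i: "i \<in> {1..n}"
  have "fst (fcomp G n \<psi> \<phi>) i = fst (fcomp G n \<psi> \<phi>') i" "snd (fcomp G n \<psi> \<phi>) i = snd (fcomp G n \<psi> \<phi>') i"
    using eq by simp_all
  then have "fst \<psi> (fst \<phi> i) = fst \<psi> (fst \<phi>' i)"
    and s: "snd \<phi> i \<otimes> snd \<psi> (fst \<phi> i) = snd \<phi>' i \<otimes> snd \<psi> (fst \<phi>' i)"
    using i by (simp_all add: fcomp_def)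
  then have f: "fst \<phi> i = fst \<phi>' i"
    using inj_onD[OF homsD(2)[OF assms(3)]] homsD(4)[OF assms(1) i] homsD(4)[OF assms(2) i] by blast
  then show "fst \<phi> i = fst \<phi>' i \<and> snd \<phi> i = snd \<phi>' i"
    using s homsD(5)[OF assms(1) i] homsD(5)[OF assms(2) i]
      homsD(5)[OF assms(3) homsD(4)[OF assms(2) i]] by simp
qed

lemma set_mor_in:
  assumes "finite X" "finite Y" "inj_on f X" "f ` X \<subseteq> Y"
  shows "set_mor G X Y f \<in> homs G (card X) (card Y)"
proof (rule homsI)
  have "inj_on (index Y \<circ> (f \<circ> enum X)) {1..card X}"
  proof (intro comp_inj_on)
    show "inj_on (enum X) {1..card X}" "inj_on f (enum X ` {1..card X})"
      using enum_bij[OF assms(1)] assms(3) by (auto simp: bij_betw_def)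
    have "(f \<circ> enum X) ` {1..card X} \<subseteq> Y" using enum_in[OF assms(1)] assms(4) by auto
    then show "inj_on (index Y) ((f \<circ> enum X) ` {1..card X})"
      using index_bij[OF assms(2)] by (auto simp: bij_betw_def intro: inj_on_subset)
  qed
  then show "inj_on (fst (set_mor G X Y f)) {1..card X}"
    unfolding set_mor_def fst_conv by (simp add: inj_on_restrict_eq comp_def)
  have "index Y (f (enum X i)) \<in> {1..card Y}" if "i \<in> {1..card X}" for i
    using enum_in[OF assms(1) that] assms(4) by (intro index_in[OF assms(2)]) auto
  then show "fst (set_mor G X Y f) \<in> {1..card X} \<rightarrow>\<^sub>E {1..card Y}"
    unfolding set_mor_def fst_conv by (intro restrict_PiE_iff[THEN iffD2] ballI)
  show "snd (set_mor G X Y f) \<in> {1..card X} \<rightarrow>\<^sub>E carrier G"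
    unfolding set_mor_def snd_conv by (intro restrict_PiE_iff[THEN iffD2] ballI) simp
qed

lemma set_mor_comp:
  assumes "finite X" "finite Y" "finite Z" "inj_on f X" "f ` X \<subseteq> Y" "inj_on g Y" "g ` Y \<subseteq> Z"
  shows "fcomp G (card X) (set_mor G Y Z g) (set_mor G X Y f) = set_mor G X Z (g \<circ> f)"
proof (rule homs_eqI)
  show "fcomp G (card X) (set_mor G Y Z g) (set_mor G X Y f) \<in> homs G (card X) (card Z)"
    using assms by (intro fcomp_in[OF set_mor_in set_mor_in])
  have "inj_on g (f ` X)" using assms inj_on_subset by blast
  then show "set_mor G X Z (g \<circ> f) \<in> homs G (card X) (card Z)"
    using assms by (intro set_mor_in comp_inj_on) auto
  fix i assume i: "i \<in> {1..card X}"
  have fY: "f (enum X i) \<in> Y" using enum_in[OF assms(1) i] assms(5) by auto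
  have "index Y (f (enum X i)) \<in> {1..card Y}" by (rule index_in[OF assms(2) fY])
  then show "fst (fcomp G (card X) (set_mor G Y Z g) (set_mor G X Y f)) i = fst (set_mor G X Z (g \<circ> f)) i \<and>
    snd (fcomp G (card X) (set_mor G Y Z g) (set_mor G X Y f)) i = snd (set_mor G X Z (g \<circ> f)) i"
    unfolding fcomp_def set_mor_def using i by (simp add: enum_index[OF assms(2) fY])
qed

lemma set_mor_id:
  assumes "finite X"
  shows "set_mor G X X id = fid G (card X)"
  unfolding set_mor_def fid_def by (auto simp: restrict_def index_enum[OF assms])

text \<open>The inclusion of \<open>U\<close> has trivial labels, so the first factor can keep the
  whole label of \<open>\<phi>\<close>.\<close>

lemma set_mor_factor:
  assumes Z: "finite Z" and U: "U \<subseteq> Z" and \<phi>: "\<phi> \<in> homs G n (card Z)"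
    and im: "enum Z ` fst \<phi> ` {1..n} \<subseteq> U"
  obtains \<phi>' where "\<phi>' \<in> homs G n (card U)" "\<phi> = fcomp G n (set_mor G U Z id) \<phi>'"
proof
  have finU: "finite U" using U Z finite_subset by blast
  define \<phi>' where "\<phi>' = (restrict (\<lambda>j. index U (enum Z (fst \<phi> j))) {1..n}, snd \<phi>)"
  have inU: "enum Z (fst \<phi> j) \<in> U" if "j \<in> {1..n}" for j using im that by auto
  show \<phi>': "\<phi>' \<in> homs G n (card U)"
  proof (rule homsI)
    show "fst \<phi>' \<in> {1..n} \<rightarrow>\<^sub>E {1..card U}"
      unfolding \<phi>'_def fst_conv
      by (intro restrict_PiE_iff[THEN iffD2] ballI index_in[OF finU inU])
    have "inj_on (index U \<circ> (enum Z \<circ> fst \<phi>)) {1..n}"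
    proof (intro comp_inj_on)
      show "inj_on (fst \<phi>) {1..n}" by (rule homsD(2)[OF \<phi>])
      have "fst \<phi> ` {1..n} \<subseteq> {1..card Z}" using homsD(4)[OF \<phi>] by auto
      then show "inj_on (enum Z) (fst \<phi> ` {1..n})"
        using enum_bij[OF Z] by (auto simp: bij_betw_def intro: inj_on_subset)
      show "inj_on (index U) ((enum Z \<circ> fst \<phi>) ` {1..n})"
        using index_bij[OF finU] im by (auto simp: bij_betw_def image_comp intro: inj_on_subset)
    qed
    then show "inj_on (fst \<phi>') {1..n}"
      unfolding \<phi>'_def fst_conv by (simp add: inj_on_restrict_eq comp_def)
    show "snd \<phi>' \<in> {1..n} \<rightarrow>\<^sub>E carrier G" using homsD(3)[OF \<phi>] by (simp add: \<phi>'_def)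
  qed
  have mor: "set_mor G U Z id \<in> homs G (card U) (card Z)" using finU Z U by (intro set_mor_in) auto
  show "\<phi> = fcomp G n (set_mor G U Z id) \<phi>'"
  proof (rule homs_eqI[OF \<phi> fcomp_in[OF \<phi>' mor]])
    fix i assume i: "i \<in> {1..n}"
    have "index U (enum Z (fst \<phi> i)) \<in> {1..card U}" by (rule index_in[OF finU inU[OF i]])
    then show "fst \<phi> i = fst (fcomp G n (set_mor G U Z id) \<phi>') i \<and> snd \<phi> i = snd (fcomp G n (set_mor G U Z id) \<phi>') i"
      using i homsD(4,5)[OF \<phi> i]
      by (simp add: fcomp_def \<phi>'_def set_mor_def enum_index[OF finU inU[OF i]] index_enum[OF Z])
  qed
qed

end

text \<open>Extend from a basis of \<open>U\<close>; the two maps agree on a subspace containing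
  this basis.\<close>

lemma (in vector_space) linear_extension:
  assumes U: "subspace U"
    and add: "\<And>v w. \<lbrakk>v \<in> U; w \<in> U\<rbrakk> \<Longrightarrow> h (v + w) = h v + h w"
    and scl: "\<And>c v. v \<in> U \<Longrightarrow> h (scale c v) = scale c (h v)"
  shows "\<exists>g. module_hom scale scale g \<and> (\<forall>v\<in>U. g v = h v)"
proof -
  interpret vector_space_pair scale scale by unfold_locales
  obtain B where B: "B \<subseteq> U" "independent B" "U \<subseteq> span B"
    using maximal_independent_subset by blast
  obtain g where g: "Vector_Spaces.linear scale scale g" "\<forall>x\<in>B. g x = h x"
    using linear_independent_extend[OF B(2)] by blast
  then have gm: "module_hom scale scale g" by (simp add: module_hom_iff_linear)
  have h0: "h 0 = 0" using scl[of 0 0] subspace_0[OF U] by simp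
  have "subspace {v \<in> U. g v = h v}"
    using U add scl h0 module_hom.add[OF gm] module_hom.scale[OF gm] module_hom.zero[OF gm]
    by (intro subspaceI) (auto intro: subspace_add subspace_scale subspace_0)
  then have "span B \<subseteq> {v \<in> U. g v = h v}" using B g by (intro span_minimal) auto
  then show ?thesis using gm B by blast
qed

section \<open>The functor on finite sets attached to a module\<close>

locale fig_mod = group G for G :: "('g, 'b) monoid_scheme" (structure) +
  fixes scale :: "'k::field \<Rightarrow> 'v::ab_group_add \<Rightarrow> 'v"
    and V :: "nat \<Rightarrow> 'v set"
    and act :: "nat \<Rightarrow> nat \<Rightarrow> 'g fimor \<Rightarrow> 'v \<Rightarrow> 'v"
  assumes fig: "fig_module G scale V act"
begin

lemma vs: "vector_space scale" using fig unfolding fig_module_def by blast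

sublocale vector_space scale by (rule vs)

lemma V_subspace: "subspace (V n)" using fig unfolding fig_module_def by blast

lemma act_in: "\<lbrakk>\<phi> \<in> homs G n m; v \<in> V n\<rbrakk> \<Longrightarrow> act n m \<phi> v \<in> V m"
  using fig unfolding fig_module_def by blast

lemma act_add: "\<lbrakk>\<phi> \<in> homs G n m; v \<in> V n; w \<in> V n\<rbrakk> \<Longrightarrow> act n m \<phi> (v + w) = act n m \<phi> v + act n m \<phi> w"
  using fig unfolding fig_module_def by blast

lemma act_scale: "\<lbrakk>\<phi> \<in> homs G n m; v \<in> V n\<rbrakk> \<Longrightarrow> act n m \<phi> (scale c v) = scale c (act n m \<phi> v)"
  using fig unfolding fig_module_def by blast

lemma act_fid: "v \<in> V n \<Longrightarrow> act n n (fid G n) v = v"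
  using fig unfolding fig_module_def by blast

lemma act_fcomp: "\<lbrakk>\<phi> \<in> homs G n m; \<psi> \<in> homs G m l; v \<in> V n\<rbrakk>
    \<Longrightarrow> act n l (fcomp G n \<psi> \<phi>) v = act m l \<psi> (act n m \<phi> v)"
  using fig unfolding fig_module_def by blast

lemma act_0: "\<phi> \<in> homs G n m \<Longrightarrow> act n m \<phi> 0 = 0"
  using act_scale[of \<phi> n m 0 0] subspace_0[OF V_subspace] by simp

lemma act_sum: "\<lbrakk>\<phi> \<in> homs G n m; \<And>x. x \<in> S \<Longrightarrow> f x \<in> V n\<rbrakk>
    \<Longrightarrow> act n m \<phi> (\<Sum>x\<in>S. f x) = (\<Sum>x\<in>S. act n m \<phi> (f x))"
  by (induction S rule: infinite_finite_induct) 
     (simp_all add: act_0 act_add subspace_sum[OF V_subspace])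

text \<open>The extension to all of \<open>'v\<close> is only a convenience: it makes the structure maps additive
  without membership side conditions.\<close>
definition set_act :: "nat set \<Rightarrow> nat set \<Rightarrow> (nat \<Rightarrow> nat) \<Rightarrow> 'v \<Rightarrow> 'v" where
  "set_act X Y f = (SOME g. module_hom scale scale g \<and>
     (finite X \<and> finite Y \<and> inj_on f X \<and> f ` X \<subseteq> Y \<longrightarrow>
       (\<forall>v\<in>V (card X). g v = act (card X) (card Y) (set_mor G X Y f) v)))"

lemma set_act:
  shows set_act_hom: "module_hom scale scale (set_act X Y f)"
    and set_act_eq: "\<lbrakk>finite X; finite Y; inj_on f X; f ` X \<subseteq> Y; v \<in> V (card X)\<rbrakk>
      \<Longrightarrow> set_act X Y f v = act (card X) (card Y) (set_mor G X Y f) v"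
proof -
  have "\<exists>g. module_hom scale scale g \<and>
     (finite X \<and> finite Y \<and> inj_on f X \<and> f ` X \<subseteq> Y \<longrightarrow>
       (\<forall>v\<in>V (card X). g v = act (card X) (card Y) (set_mor G X Y f) v))"
  proof (cases "finite X \<and> finite Y \<and> inj_on f X \<and> f ` X \<subseteq> Y")
    case True
    then have "set_mor G X Y f \<in> homs G (card X) (card Y)" by (intro set_mor_in) auto
    then have "\<exists>g. module_hom scale scale g \<and>
       (\<forall>v\<in>V (card X). g v = act (card X) (card Y) (set_mor G X Y f) v)"
      by (intro linear_extension V_subspace act_add act_scale)
    then show ?thesis by blast
  next
    case False
    \<comment> \<open>Outside the intended domain any linear map is allowed; the identity shows that
      one exists.\<close>
    have "module_hom scale scale (\<lambda>v. v)" by unfold_locales auto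
    then show ?thesis using False by blast
  qed
  note * = someI_ex[OF this, folded set_act_def]
  show "module_hom scale scale (set_act X Y f)" using * by blast
  show "\<lbrakk>finite X; finite Y; inj_on f X; f ` X \<subseteq> Y; v \<in> V (card X)\<rbrakk>
      \<Longrightarrow> set_act X Y f v = act (card X) (card Y) (set_mor G X Y f) v" using * by blast
qed

sublocale fi_functor scale "\<lambda>X. V (card X)" set_act
proof (intro fi_functor.intro fi_functor_axioms.intro vs)
  show "subspace (V (card X))" for X by (rule V_subspace)
  show "module_hom scale scale (set_act X Y f)" for X Y f by (rule set_act_hom)
  show "set_act X Y f v \<in> V (card Y)"
    if "finite X" "finite Y" "inj_on f X" "f ` X \<subseteq> Y" "v \<in> V (card X)" for X Y f v
    unfolding set_act_eq[OF that] using that by (intro act_in set_mor_in)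
  show "set_act Y Z g (set_act X Y f v) = set_act X Z (g \<circ> f) v"
    if h: "finite X" "finite Y" "finite Z" "inj_on f X" "f ` X \<subseteq> Y" "inj_on g Y" "g ` Y \<subseteq> Z"
      "v \<in> V (card X)" for X Y Z f g v
  proof -
    have "inj_on g (f ` X)" using h inj_on_subset by blast
    then have gf: "inj_on (g \<circ> f) X" "(g \<circ> f) ` X \<subseteq> Z" using h by (auto intro: comp_inj_on)
    have "act (card X) (card Y) (set_mor G X Y f) v \<in> V (card Y)"
      using h by (intro act_in set_mor_in)
    then show ?thesis
      unfolding set_act_eq[OF h(1,2,4,5,8)] set_act_eq[OF h(1,3) gf h(8)] set_mor_comp[OF h(1-7), symmetric]
      using h by (subst set_act_eq) (auto intro!: act_fcomp[symmetric] set_mor_in)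
  qed
  show "set_act X X id v = v" if "finite X" "v \<in> V (card X)" for X v
    using that by (subst set_act_eq) (auto simp: set_mor_id act_fid)
  show "set_act X Y f v = set_act X Y g v"
    if h: "finite X" "finite Y" "inj_on f X" "f ` X \<subseteq> Y" "\<And>x. x \<in> X \<Longrightarrow> f x = g x" "v \<in> V (card X)"
    for X Y f g v
  proof -
    have g: "inj_on g X" "g ` X \<subseteq> Y" using h inj_on_cong[of X f g] by auto
    have "set_mor G X Y f = set_mor G X Y g"
      unfolding set_mor_def using h(5) enum_in[OF h(1)] by (auto simp: restrict_def)
    then show ?thesis unfolding set_act_eq[OF h(1-4,6)] set_act_eq[OF h(1,2) g h(6)] by simp
  qed
qed

lemma L_eq: "\<lbrakk>finite Y; X \<subseteq> Y; v \<in> V (card X)\<rbrakk>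
    \<Longrightarrow> L X Y v = act (card X) (card Y) (set_mor G X Y id) v"
  by (rule set_act_eq) (auto intro: finite_subset)

lemma L_mor: "\<lbrakk>finite Y; X \<subseteq> Y\<rbrakk> \<Longrightarrow> set_mor G X Y id \<in> homs G (card X) (card Y)"
  by (rule set_mor_in) (auto intro: finite_subset)

lemma lowpart_subset: "lowpart G scale V act n \<subseteq> V n"
  unfolding lowpart_def by (rule span_minimal) (auto intro: act_in V_subspace)

text \<open>A map from fewer than \<open>card Z\<close> points misses some \<open>z\<close> and
  factors through \<open>Z - {z}\<close>. So images under arbitrary labelled morphisms are accounted
  for by plain inclusions of faces.\<close>

lemma lowpart_subset_faces:
  assumes Z: "finite Z"
  shows "lowpart G scale V act (card Z) \<subseteq> faces Z Z"
  unfolding lowpart_def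
proof (rule span_minimal[OF _ faces_subspace], clarify)
  fix m \<phi> v assume m: "m < card Z" and \<phi>: "\<phi> \<in> homs G m (card Z)" and v: "v \<in> V m"
  have "card (enum Z ` fst \<phi> ` {1..m}) \<le> m"
    by (metis card_atLeastAtMost card_image_le diff_Suc_1 finite_atLeastAtMost finite_imageI le_trans)
  moreover have "enum Z ` fst \<phi> ` {1..m} \<subseteq> Z" using homsD(4)[OF \<phi>] enum_in[OF Z] by auto
  ultimately have "\<exists>z\<in>Z. z \<notin> enum Z ` fst \<phi> ` {1..m}" using m by (metis leD subsetI subset_antisym)
  then obtain z where z: "z \<in> Z" "enum Z ` fst \<phi> ` {1..m} \<subseteq> Z - {z}"
    using \<open>enum Z ` fst \<phi> ` {1..m} \<subseteq> Z\<close> by blast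
  obtain \<phi>' where \<phi>': "\<phi>' \<in> homs G m (card (Z - {z}))"
      "\<phi> = fcomp G m (set_mor G (Z - {z}) Z id) \<phi>'"
    by (rule set_mor_factor[OF Z _ \<phi> z(2)]) auto
  have v': "act m (card (Z - {z})) \<phi>' v \<in> V (card (Z - {z}))" using act_in \<phi>' v by blast
  have "act m (card Z) \<phi> v = L (Z - {z}) Z (act m (card (Z - {z})) \<phi>' v)"
    unfolding \<phi>'(2) using L_eq[OF Z _ v'] act_fcomp[OF \<phi>'(1) L_mor[OF Z] v] by auto
  then show "act m (card Z) \<phi> v \<in> faces Z Z" using faces_one[OF Z z(1) v'] by simp
qed

lemma face_in_lowpart:
  assumes "finite Z" "z \<in> Z" "v \<in> V (card (Z - {z}))"
  shows "L (Z - {z}) Z v \<in> lowpart G scale V act (card Z)"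
proof -
  have "card (Z - {z}) < card Z" using assms by (metis card_Diff1_less)
  then show ?thesis
    unfolding lowpart_def L_eq[OF assms(1) Diff_subset assms(3)]
    by (intro span_base UN_I[of "card (Z - {z})"] UN_I[OF L_mor[OF assms(1) Diff_subset]] imageI assms(3))
       simp
qed

end

section \<open>The canonical presentation\<close>

lemma sum_fun_eval: "(\<Sum>i\<in>S. f i) y = (\<Sum>i\<in>S. f i y)"
  for f :: "'i \<Rightarrow> 'x \<Rightarrow> 'a::comm_monoid_add"
  by (induction S rule: infinite_finite_induct) auto

lemma vector_space_fscale: "vector_space (fscale :: 'k::field \<Rightarrow> ('x \<Rightarrow> 'k) \<Rightarrow> 'x \<Rightarrow> 'k)"
  by unfold_locales (auto simp: fscale_def fun_eq_iff algebra_simps)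

context fig_mod
begin

section \<open>The free module and its action on basis elements\<close>

definition basis :: "nat \<Rightarrow> ('v, 'g) fbasis set" where
  "basis m = {x. snd (fst x) \<in> V (fst (fst x)) \<and> snd x \<in> homs G (fst (fst x)) m}"

text \<open>\<open>freeAct\<close> is the push-forward of coefficients along this map of basis
  elements.\<close>

definition push :: "'g fimor \<Rightarrow> ('v, 'g) fbasis \<Rightarrow> ('v, 'g) fbasis" where
  "push \<psi> x = (fst x, fcomp G (fst (fst x)) \<psi> (snd x))"

abbreviation F :: "nat \<Rightarrow> (('v, 'g) fbasis \<Rightarrow> 'k) set" where
  "F \<equiv> freeF G V"

lemma F_iff: "c \<in> F m \<longleftrightarrow> finite {x. c x \<noteq> 0} \<and> {x. c x \<noteq> 0} \<subseteq> basis m"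
  unfolding freeF_def basis_def by auto

lemma push_in: "\<lbrakk>\<psi> \<in> homs G m l; x \<in> basis m\<rbrakk> \<Longrightarrow> push \<psi> x \<in> basis l"
  unfolding basis_def push_def by (auto intro: fcomp_in)

lemma push_inj: "\<psi> \<in> homs G m l \<Longrightarrow> inj_on (push \<psi>) (basis m)"
  by (rule inj_onI) (auto simp: basis_def push_def prod_eq_iff[where 'b = "'g fimor"] dest: fcomp_cancel)

lemma push_push: "\<lbrakk>\<psi> \<in> homs G m l; \<chi> \<in> homs G l k; x \<in> basis m\<rbrakk> \<Longrightarrow>
    push \<chi> (push \<psi> x) = push (fcomp G m \<chi> \<psi>) x"
  unfolding basis_def push_def by (auto simp: fcomp_assoc)

lemma push_fid: "x \<in> basis m \<Longrightarrow> push (fid G m) x = x"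
  unfolding basis_def push_def by (auto simp: fcomp_fid)

text \<open>Injectivity of \<open>push\<close> leaves at most one contributing term in the defining
  sum.\<close>

lemma freeAct_push:
  assumes "\<psi> \<in> homs G m l" "c \<in> F m" "x \<in> basis m"
  shows "freeAct G m l \<psi> c (push \<psi> x) = c x"
proof -
  have *: "x' = x" if "c x' \<noteq> 0" "push \<psi> x' = push \<psi> x" for x'
    using inj_onD[OF push_inj[OF assms(1)] that(2)] that(1) assms(2,3) unfolding F_iff by blast
  show ?thesis
  proof (cases "c x = 0")
    case True
    then have "{x'. c x' \<noteq> 0 \<and> push \<psi> x' = push \<psi> x} = {}" using * by blast
    then show ?thesis unfolding freeAct_def push_def[symmetric] using True by (simp only: sum.empty)
  next
    case False
    then have "{x'. c x' \<noteq> 0 \<and> push \<psi> x' = push \<psi> x} = {x}" using * by blast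
    then show ?thesis unfolding freeAct_def push_def[symmetric] by simp
  qed
qed

lemma freeAct_outside:
  assumes "c \<in> F m" "y \<notin> push \<psi> ` basis m"
  shows "freeAct G m l \<psi> c y = 0"
proof -
  have "{x. c x \<noteq> 0 \<and> push \<psi> x = y} = {}" using assms unfolding F_iff by auto
  then show ?thesis unfolding freeAct_def push_def[symmetric] by (simp only: sum.empty)
qed

lemma freeAct_eqI:
  assumes "\<psi> \<in> homs G m l" "c \<in> F m"
    and "\<And>x. x \<in> basis m \<Longrightarrow> e (push \<psi> x) = c x" "\<And>y. y \<notin> push \<psi> ` basis m \<Longrightarrow> e y = 0"
  shows "freeAct G m l \<psi> c = e"
proof
  fix y
  show "freeAct G m l \<psi> c y = e y"
    by (cases "y \<in> push \<psi> ` basis m")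
       (auto simp: freeAct_push[OF assms(1,2)] freeAct_outside[OF assms(2)] assms(3,4))
qed

lemma freeAct_support:
  assumes "\<psi> \<in> homs G m l" "c \<in> F m"
  shows "{y. freeAct G m l \<psi> c y \<noteq> 0} = push \<psi> ` {x. c x \<noteq> 0}"
proof (intro subset_antisym subsetI)
  fix y assume y: "y \<in> {y. freeAct G m l \<psi> c y \<noteq> 0}"
  then have "y \<in> push \<psi> ` basis m" using freeAct_outside[OF assms(2)] by blast
  then show "y \<in> push \<psi> ` {x. c x \<noteq> 0}" using freeAct_push[OF assms] y by auto
next
  fix y assume "y \<in> push \<psi> ` {x. c x \<noteq> 0}"
  then show "y \<in> {y. freeAct G m l \<psi> c y \<noteq> 0}"
    using freeAct_push[OF assms] assms(2) unfolding F_iff by auto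
qed

lemma F_subspace: "module.subspace fscale (F m)"
proof -
  interpret f: vector_space "fscale :: 'k \<Rightarrow> (('v, 'g) fbasis \<Rightarrow> 'k) \<Rightarrow> _" by (rule vector_space_fscale)
  show ?thesis
  proof (rule f.subspaceI)
    show "0 \<in> F m" by (simp add: F_iff)
  next
    fix c d assume "c \<in> F m" "d \<in> F m"
    moreover have "{x. (c + d) x \<noteq> 0} \<subseteq> {x. c x \<noteq> 0} \<union> {x. d x \<noteq> 0}" by auto
    ultimately show "c + d \<in> F m" unfolding F_iff by (meson finite_UnI finite_subset le_sup_iff order_trans)
  next
    fix a c assume "c \<in> F m"
    moreover have "{x. fscale a c x \<noteq> 0} \<subseteq> {x. c x \<noteq> 0}" by (auto simp: fscale_def)
    ultimately show "fscale a c \<in> F m" unfolding F_iff by (meson finite_subset order_trans)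
  qed
qed

lemma freeAct_in: "\<lbrakk>\<psi> \<in> homs G m l; c \<in> F m\<rbrakk> \<Longrightarrow> freeAct G m l \<psi> c \<in> F l"
  unfolding F_iff[of _ l] using push_in[of \<psi> m l] by (simp add: freeAct_support F_iff) blast

lemma F_fig: "fig_module G fscale F (freeAct G)"
proof -
  interpret f: vector_space "fscale :: 'k \<Rightarrow> (('v, 'g) fbasis \<Rightarrow> 'k) \<Rightarrow> _" by (rule vector_space_fscale)
  show ?thesis
    unfolding fig_module_def
  proof (intro conjI allI ballI)
    show "vector_space (fscale :: 'k \<Rightarrow> (('v, 'g) fbasis \<Rightarrow> 'k) \<Rightarrow> _)" by (rule vector_space_fscale)
    show "f.subspace (F n)" for n by (rule F_subspace)
  next
    fix n m \<phi> c assume "\<phi> \<in> homs G n m" "c \<in> F n"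
    then show "freeAct G n m \<phi> c \<in> F m" by (rule freeAct_in)
  next
    fix n m \<phi> c d assume h: "\<phi> \<in> homs G n m" "c \<in> F n" "d \<in> F n"
    show "freeAct G n m \<phi> (c + d) = freeAct G n m \<phi> c + freeAct G n m \<phi> d"
      by (rule freeAct_eqI) (use h in \<open>auto simp: freeAct_push freeAct_outside intro: f.subspace_add[OF F_subspace]\<close>)
  next
    fix n m \<phi> a c assume h: "\<phi> \<in> homs G n m" "c \<in> F n"
    show "freeAct G n m \<phi> (fscale a c) = fscale a (freeAct G n m \<phi> c)"
      by (rule freeAct_eqI[OF h(1) f.subspace_scale[OF F_subspace h(2)]])
         (use h in \<open>auto simp: freeAct_push freeAct_outside fscale_def\<close>)
  next
    fix n c assume h: "c \<in> F n"
    show "freeAct G n n (fid G n) c = c"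
      by (rule freeAct_eqI[OF fid_in h]) (use h push_fid in \<open>force simp: F_iff image_iff\<close>)+
  next
    fix n m l \<phi> \<psi> c assume h: "\<phi> \<in> homs G n m" "\<psi> \<in> homs G m l" "c \<in> F n"
    show "freeAct G n l (fcomp G n \<psi> \<phi>) c = freeAct G m l \<psi> (freeAct G n m \<phi> c)"
    proof (rule freeAct_eqI[OF fcomp_in[OF h(1,2)] h(3)])
      fix x assume x: "x \<in> basis n"
      show "freeAct G m l \<psi> (freeAct G n m \<phi> c) (push (fcomp G n \<psi> \<phi>) x) = c x"
        unfolding push_push[OF h(1,2) x, symmetric]
        using h x by (simp add: freeAct_push freeAct_in push_in)
    next
      fix y assume y: "y \<notin> push (fcomp G n \<psi> \<phi>) ` basis n"
      show "freeAct G m l \<psi> (freeAct G n m \<phi> c) y = 0"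
      proof (cases "y \<in> push \<psi> ` basis m")
        case True
        then obtain z where z: "z \<in> basis m" "y = push \<psi> z" by blast
        have "z \<notin> push \<phi> ` basis n" using y z push_push[OF h(1,2)] by auto
        then show ?thesis using z h by (simp add: freeAct_push freeAct_in freeAct_outside)
      qed (use h in \<open>simp add: freeAct_outside freeAct_in\<close>)
    qed
  qed
qed

lemma F_fig_mod: "fig_mod G fscale F (freeAct G)"
  by unfold_locales (rule F_fig)

section \<open>The augmentation and its kernel\<close>

abbreviation aug :: "nat \<Rightarrow> (('v, 'g) fbasis \<Rightarrow> 'k) \<Rightarrow> 'v" where
  "aug \<equiv> augm scale act"

lemma aug_superset:
  assumes "finite S" "{x. c x \<noteq> 0} \<subseteq> S"
  shows "aug m c = (\<Sum>x\<in>S. scale (c x) (act (fst (fst x)) m (snd x) (snd (fst x))))"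
  unfolding augm_def using assms by (intro sum.mono_neutral_left) auto

lemma aug_0: "aug m 0 = 0" by (simp add: augm_def)

lemma aug_add:
  assumes "c \<in> F m" "d \<in> F m"
  shows "aug m (c + d) = aug m c + aug m d"
proof -
  define S where "S = {x. c x \<noteq> 0} \<union> {x. d x \<noteq> 0}"
  have S: "finite S" using assms by (auto simp: S_def F_iff)
  have "{x. (c + d) x \<noteq> 0} \<subseteq> S" "{x. c x \<noteq> 0} \<subseteq> S" "{x. d x \<noteq> 0} \<subseteq> S" by (auto simp: S_def)
  then show ?thesis using S by (simp add: aug_superset scale_left_distrib sum.distrib)
qed

lemma aug_scale:
  assumes "c \<in> F m"
  shows "aug m (fscale a c) = scale a (aug m c)"
proof -
  have S: "finite {x. c x \<noteq> 0}" using assms by (auto simp: F_iff)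
  have "{x. fscale a c x \<noteq> 0} \<subseteq> {x. c x \<noteq> 0}" by (auto simp: fscale_def)
  then show ?thesis using aug_superset[OF S] by (simp add: fscale_def scale_sum_right)
qed

lemma aug_in: "c \<in> F m \<Longrightarrow> aug m c \<in> V m"
  unfolding augm_def F_iff basis_def
  by (intro subspace_sum[OF V_subspace] subspace_scale[OF V_subspace] act_in) auto

lemma aug_act:
  assumes h: "\<psi> \<in> homs G m l" "c \<in> F m"
  shows "aug l (freeAct G m l \<psi> c) = act m l \<psi> (aug m c)"
proof -
  let ?S = "{x. c x \<noteq> 0}"
  have S: "?S \<subseteq> basis m" using h by (simp add: F_iff)
  have "aug l (freeAct G m l \<psi> c) =
      (\<Sum>x\<in>?S. scale (freeAct G m l \<psi> c (push \<psi> x))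
        (act (fst (fst (push \<psi> x))) l (snd (push \<psi> x)) (snd (fst (push \<psi> x)))))"
    unfolding augm_def freeAct_support[OF h]
    using inj_on_subset[OF push_inj[OF h(1)] S] by (simp add: sum.reindex)
  also have "\<dots> = (\<Sum>x\<in>?S. act m l \<psi> (scale (c x) (act (fst (fst x)) m (snd x) (snd (fst x)))))"
  proof (rule sum.cong[OF refl])
    fix x assume "x \<in> ?S"
    then have x: "x \<in> basis m" using S by blast
    then have "snd x \<in> homs G (fst (fst x)) m" "snd (fst x) \<in> V (fst (fst x))" by (auto simp: basis_def)
    then show "scale (freeAct G m l \<psi> c (push \<psi> x))
        (act (fst (fst (push \<psi> x))) l (snd (push \<psi> x)) (snd (fst (push \<psi> x)))) =
        act m l \<psi> (scale (c x) (act (fst (fst x)) m (snd x) (snd (fst x))))"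
      unfolding freeAct_push[OF h x] by (simp add: push_def act_fcomp act_scale act_in h)
  qed
  also have "\<dots> = act m l \<psi> (aug m c)"
    unfolding augm_def using S h
    by (intro act_sum[symmetric] subspace_scale[OF V_subspace] act_in) (auto simp: basis_def)
  finally show ?thesis .
qed

abbreviation K :: "nat \<Rightarrow> (('v, 'g) fbasis \<Rightarrow> 'k) set" where
  "K \<equiv> kerK G scale V act"

text \<open>Closure under the action comes from \<open>aug_act\<close>, closure under sums and
  scalars from linearity of \<open>aug\<close>; the remaining laws are inherited from
  \<open>F\<close>.\<close>

lemma K_fig_mod: "fig_mod G fscale K (freeAct G)"
proof
  interpret F: fig_mod G fscale F "freeAct G" by (rule F_fig_mod)
  have sub: "K m \<subseteq> F m" for m by (auto simp: kerK_def)
  show "fig_module G fscale K (freeAct G)"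
    unfolding fig_module_def
  proof (intro conjI allI ballI)
    show "vector_space (fscale :: 'k \<Rightarrow> (('v, 'g) fbasis \<Rightarrow> 'k) \<Rightarrow> _)" by (rule vector_space_fscale)
    show "F.subspace (K n)" for n
    proof (rule F.subspaceI)
      show "0 \<in> K n" by (simp add: kerK_def aug_0 F.subspace_0[OF F_subspace])
      show "c + d \<in> K n" if "c \<in> K n" "d \<in> K n" for c d
        using that by (simp add: kerK_def aug_add F.subspace_add[OF F_subspace])
      show "fscale a c \<in> K n" if "c \<in> K n" for a c
        using that by (simp add: kerK_def aug_scale F.subspace_scale[OF F_subspace])
    qed
    show "freeAct G n m \<phi> c \<in> K m" if "\<phi> \<in> homs G n m" "c \<in> K n" for n m \<phi> c
      using that by (simp add: kerK_def freeAct_in aug_act act_0)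
  next
    fix n m \<phi> c d assume "\<phi> \<in> homs G n m" "c \<in> K n" "d \<in> K n"
    then show "freeAct G n m \<phi> (c + d) = freeAct G n m \<phi> c + freeAct G n m \<phi> d"
      using sub F.act_add by blast
  next
    fix n m \<phi> a c assume "\<phi> \<in> homs G n m" "c \<in> K n"
    then show "freeAct G n m \<phi> (fscale a c) = fscale a (freeAct G n m \<phi> c)"
      using sub F.act_scale by blast
  next
    fix n c assume "c \<in> K n"
    then show "freeAct G n n (fid G n) c = c" using sub F.act_fid by blast
  next
    fix n m l \<phi> \<psi> c assume "\<phi> \<in> homs G n m" "\<psi> \<in> homs G m l" "c \<in> K n"
    then show "freeAct G n l (fcomp G n \<psi> \<phi>) c = freeAct G m l \<psi> (freeAct G n m \<phi> c)"
      using sub F.act_fcomp by blast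
  qed
qed

interpretation F: fig_mod G fscale F "freeAct G" by (rule F_fig_mod)

section \<open>Acyclicity of the free module\<close>

definition points :: "nat set \<Rightarrow> ('v, 'g) fbasis \<Rightarrow> nat set" where
  "points Z x = enum Z ` fst (snd x) ` {1..fst (fst x)}"

text \<open>By \<open>set_mor_factor\<close>, coming from \<open>U\<close> is only a condition on
  \<open>points\<close>. This reduces the acyclicity of \<open>F\<close> to the combinatorics of
  supports.\<close>

lemma push_image:
  assumes Z: "finite Z" and U: "U \<subseteq> Z"
  shows "push (set_mor G U Z id) ` basis (card U) = {x \<in> basis (card Z). points Z x \<subseteq> U}"
proof (intro subset_antisym subsetI)
  fix y assume "y \<in> push (set_mor G U Z id) ` basis (card U)"
  then obtain x where x: "x \<in> basis (card U)" "y = push (set_mor G U Z id) x" by blast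
  have "y \<in> basis (card Z)" unfolding x(2) by (rule push_in[OF L_mor[OF Z U] x(1)])
  moreover have "points Z y \<subseteq> U"
  proof -
    have finU: "finite U" using Z U by (rule rev_finite_subset)
    have "enum Z (fst (snd y) i) \<in> U" if i: "i \<in> {1..fst (fst x)}" for i
    proof -
      have "snd x \<in> homs G (fst (fst x)) (card U)" using x(1) by (simp add: basis_def)
      from homsD(4)[OF this i] have j: "fst (snd x) i \<in> {1..card U}" .
      then have e: "enum U (fst (snd x) i) \<in> U" using enum_in finU by blast
      then show ?thesis
        using i j U Z by (simp add: x(2) push_def fcomp_def set_mor_def enum_index subset_iff)
    qed
    then show ?thesis unfolding points_def by (auto simp: x(2) push_def)
  qed
  ultimately show "y \<in> {x \<in> basis (card Z). points Z x \<subseteq> U}" by blast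
next
  fix y assume "y \<in> {x \<in> basis (card Z). points Z x \<subseteq> U}"
  then have y: "snd (fst y) \<in> V (fst (fst y))" "snd y \<in> homs G (fst (fst y)) (card Z)"
    "enum Z ` fst (snd y) ` {1..fst (fst y)} \<subseteq> U" by (auto simp: basis_def points_def)
  obtain \<phi>' where "\<phi>' \<in> homs G (fst (fst y)) (card U)"
      "snd y = fcomp G (fst (fst y)) (set_mor G U Z id) \<phi>'"
    by (rule set_mor_factor[OF Z U y(2,3)])
  then have "(fst y, \<phi>') \<in> basis (card U)" "y = push (set_mor G U Z id) (fst y, \<phi>')"
    using y(1) by (simp_all add: basis_def push_def prod_eq_iff[of y])
  then show "y \<in> push (set_mor G U Z id) ` basis (card U)" by blast
qed

lemma F_L_support:
  assumes Z: "finite Z" and U: "U \<subseteq> Z" and c: "c \<in> F (card U)" and x: "F.L U Z c x \<noteq> 0"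
  shows "x \<in> basis (card Z)" "points Z x \<subseteq> U"
proof -
  have "x \<in> push (set_mor G U Z id) ` basis (card U)"
    using freeAct_outside[OF c, of x "set_mor G U Z id" "card Z"] x F.L_eq[OF Z U c] by fastforce
  then show "x \<in> basis (card Z)" "points Z x \<subseteq> U" unfolding push_image[OF Z U] by auto
qed

lemma F_L_inj:
  assumes Z: "finite Z" and U: "U \<subseteq> Z" and c: "c \<in> F (card U)" and d: "d \<in> F (card U)"
    and eq: "F.L U Z c = F.L U Z d"
  shows "c = d"
proof
  fix x
  show "c x = d x"
  proof (cases "x \<in> basis (card U)")
    case True
    then show ?thesis
      using eq unfolding F.L_eq[OF Z U c] F.L_eq[OF Z U d]
      by (metis freeAct_push[OF L_mor[OF Z U] c] freeAct_push[OF L_mor[OF Z U] d])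
  next
    case False
    then have "c x = 0" "d x = 0" using c d unfolding F_iff by blast+
    then show ?thesis by simp
  qed
qed

text \<open>Together with \<open>F_L_inj\<close> this identifies the chain groups of
  \<open>F\<close> with subspaces of \<open>F (card Z)\<close> cut out by conditions on
  \<open>points\<close>, so chains can be defined coefficientwise.\<close>

lemma F_L_surj:
  assumes Z: "finite Z" and U: "U \<subseteq> Z" and c: "c \<in> F (card Z)"
    and pts: "\<And>x. c x \<noteq> 0 \<Longrightarrow> points Z x \<subseteq> U"
  shows "\<exists>d\<in>F (card U). F.L U Z d = c"
proof -
  let ?\<iota> = "set_mor G U Z id"
  define d where "d x = (if x \<in> basis (card U) then c (push ?\<iota> x) else 0)" for x
  have "push ?\<iota> ` {x. d x \<noteq> 0} \<subseteq> {x. c x \<noteq> 0}" by (auto simp: d_def)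
  moreover have sub: "{x. d x \<noteq> 0} \<subseteq> basis (card U)" by (auto simp: d_def)
  ultimately have "finite {x. d x \<noteq> 0}"
    using c inj_on_subset[OF push_inj[OF L_mor[OF Z U]] sub] unfolding F_iff
    by (metis finite_imageD finite_subset)
  then have d: "d \<in> F (card U)" using sub by (simp add: F_iff)
  have "freeAct G (card U) (card Z) ?\<iota> d = c"
  proof (rule freeAct_eqI[OF L_mor[OF Z U] d])
    fix y assume "y \<notin> push ?\<iota> ` basis (card U)"
    then show "c y = 0" unfolding push_image[OF Z U] using pts c unfolding F_iff by blast
  qed (simp add: d_def)
  then show ?thesis using d F.L_eq[OF Z U d] by auto
qed

text \<open>For each basis element choose a point \<open>p\<close> outside its image; adding \<open>p\<close> is a contracting
  homotopy of the Koszul complex.\<close>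
lemma F_H1_zero:
  assumes Z: "finite Z"
  shows "F.H1_zero Z"
  unfolding F.H1_zero_def
proof (intro allI impI, elim conjE)
  fix c assume c: "\<forall>z\<in>Z. c z \<in> F (card (Z - {z}))" and cyc: "(\<Sum>z\<in>Z. F.L (Z - {z}) Z (c z)) = 0"
  define C where "C z = F.L (Z - {z}) Z (c z)" for z
  have C_in: "C z \<in> F (card Z)" if "z \<in> Z" for z
    unfolding C_def using c that by (intro F.L_in Z) auto
  have C_pts: "points Z b \<subseteq> Z - {z}" if "z \<in> Z" "C z b \<noteq> 0" for z b
    using F_L_support(2)[OF Z, of "Z - {z}" "c z" b] c that unfolding C_def by auto
  have cyc': "(\<Sum>z\<in>Z. C z b) = 0" for b
    using cyc unfolding C_def[symmetric] by (metis sum_fun_eval zero_fun_apply)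
  define p where "p b = (SOME p. p \<in> Z - points Z b)" for b
  have p: "p b \<in> Z - points Z b" if "z \<in> Z" "C z b \<noteq> 0" for z b
    unfolding p_def by (rule someI[of _ z]) (use C_pts[OF that] that in auto)
  \<comment> \<open>The homotopy moves the coefficient of \<open>b\<close> in \<open>C x\<close> to
    the pair of \<open>x\<close> and \<open>p b\<close>, with antisymmetry built in. Where every
    \<open>C z b\<close> is zero, the arbitrary value of \<open>p b\<close> is harmless.\<close>
  define \<omega> where "\<omega> x y b = (if y = p b then C x b else 0) - (if x = p b then C y b else 0)" for x y b
  have "\<exists>d\<in>F (card (Z - {x, y})). F.L (Z - {x, y}) Z d = \<omega> x y" if xy: "x \<in> Z" "y \<in> Z" for x y
  proof (rule F_L_surj[OF Z])
    have "{b. \<omega> x y b \<noteq> 0} \<subseteq> {b. C x b \<noteq> 0} \<union> {b. C y b \<noteq> 0}" by (auto simp: \<omega>_def split: if_splits)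
    then show "\<omega> x y \<in> F (card Z)"
      using C_in[OF xy(1)] C_in[OF xy(2)] unfolding F_iff
      by (meson finite_UnI finite_subset le_sup_iff order_trans)
    fix b assume "\<omega> x y b \<noteq> 0"
    then consider "y = p b" "C x b \<noteq> 0" | "x = p b" "C y b \<noteq> 0" by (auto simp: \<omega>_def split: if_splits)
    then show "points Z b \<subseteq> Z - {x, y}"
      by cases (use p C_pts xy in blast)+
  qed auto
  then obtain w where w: "\<And>x y. \<lbrakk>x \<in> Z; y \<in> Z\<rbrakk> \<Longrightarrow> w x y \<in> F (card (Z - {x, y}))"
    "\<And>x y. \<lbrakk>x \<in> Z; y \<in> Z\<rbrakk> \<Longrightarrow> F.L (Z - {x, y}) Z (w x y) = \<omega> x y"
    by metis
  have "F.alt2 Z w"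
    unfolding F.alt2_def
  proof (intro conjI ballI)
    fix x assume x: "x \<in> Z"
    show "w x x = 0"
    proof (rule F_L_inj[OF Z _ w(1)[OF x x]])
      show "F.L (Z - {x, x}) Z (w x x) = F.L (Z - {x, x}) Z 0"
        unfolding w(2)[OF x x] by (auto simp: \<omega>_def)
    qed (use F.W_0 in auto)
  next
    fix x y assume xy: "x \<in> Z" "y \<in> Z"
    have eq: "Z - {y, x} = Z - {x, y}" by blast
    show "w x y = - w y x"
    proof (rule F_L_inj[OF Z _ w(1)[OF xy]])
      show "- w y x \<in> F (card (Z - {x, y}))" using w(1)[OF xy(2,1)] unfolding eq by (rule F.W_neg)
      show "F.L (Z - {x, y}) Z (w x y) = F.L (Z - {x, y}) Z (- w y x)"
        unfolding F.M_neg w(2)[OF xy] w(2)[OF xy(2,1), unfolded eq] by (auto simp: \<omega>_def)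
    qed auto
  qed (use w in auto)
  moreover have "c x = F.d2 Z w x" if x: "x \<in> Z" for x
  proof (rule F_L_inj[OF Z, of "Z - {x}"])
    show "c x \<in> F (card (Z - {x}))" using c x by blast
    show "F.d2 Z w x \<in> F (card (Z - {x}))"
      unfolding F.d2_def using w(1)[OF x] Z by (intro F.W_sum F.L_in) auto
    have "F.L (Z - {x}) Z (F.d2 Z w x) = (\<Sum>y\<in>Z. F.L (Z - {x, y}) Z (w x y))"
      unfolding F.d2_def F.M_sum using w(1)[OF x] Z by (intro sum.cong refl F.L_L) auto
    also have "\<dots> = (\<Sum>y\<in>Z. \<omega> x y)" using w(2)[OF x] by simp
    also have "\<dots> = C x"
    proof
      fix b
      \<comment> \<open>The first sum picks out \<open>y = p b\<close>; the second adds up one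
        coefficient of the whole cycle and is zero by \<open>cyc'\<close>.\<close>
      have "(\<Sum>y\<in>Z. \<omega> x y) b = (\<Sum>y\<in>Z. if y = p b then C x b else 0) - (if x = p b then \<Sum>y\<in>Z. C y b else 0)"
        by (simp add: sum_fun_eval \<omega>_def sum_subtractf)
      also have "\<dots> = (if p b \<in> Z then C x b else 0)" using Z cyc' by simp
      also have "\<dots> = C x b" using p[OF x, of b] by (cases "C x b = 0") simp_all
      finally show "(\<Sum>y\<in>Z. \<omega> x y) b = C x b" .
    qed
    finally show "F.L (Z - {x}) Z (c x) = F.L (Z - {x}) Z (F.d2 Z w x)" by (simp add: C_def)
  qed auto
  ultimately show "\<exists>w. F.alt2 Z w \<and> (\<forall>z\<in>Z. c z = F.d2 Z w z)" by blast
qed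

section \<open>From the presentation to Koszul homology\<close>

lemma aug_lift:
  assumes "v \<in> V m"
  shows "\<exists>c\<in>F m. aug m c = v"
proof -
  \<comment> \<open>The generator of the summand of the free module indexed by
    \<open>(m, v)\<close>.\<close>
  define c :: "('v, 'g) fbasis \<Rightarrow> 'k" where "c x = (if x = ((m, v), fid G m) then 1 else 0)" for x
  have c: "{x. c x \<noteq> 0} = {((m, v), fid G m)}" by (auto simp: c_def)
  have "c \<in> F m" unfolding F_iff c using assms by (auto simp: basis_def intro: fid_in)
  moreover have "aug m c = v" unfolding augm_def c using assms by (simp add: c_def act_fid)
  ultimately show ?thesis by blast
qed

lemma aug_L: "\<lbrakk>finite Y; X \<subseteq> Y; c \<in> F (card X)\<rbrakk> \<Longrightarrow> aug (card Y) (F.L X Y c) = L X Y (aug (card X) c)"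
  by (simp add: F.L_eq L_eq aug_in aug_act L_mor)

lemma aug_neg: "c \<in> F m \<Longrightarrow> aug m (- c) = - aug m c"
  using aug_add[of c m "- c"] F.subspace_neg[OF F_subspace, of c m] aug_0[of m]
  by (simp add: add_eq_0_iff)

lemma aug_sum: "(\<And>i. i \<in> S \<Longrightarrow> f i \<in> F m) \<Longrightarrow> aug m (\<Sum>i\<in>S. f i) = (\<Sum>i\<in>S. aug m (f i))"
  by (induction S rule: infinite_finite_induct)
     (simp_all add: aug_0 aug_add F.subspace_sum[OF F_subspace])

text \<open>Lift a cycle of \<open>V\<close> to \<open>F\<close>, and correct the lift by \<open>K\<close> to a cycle.\<close>
lemma H1_zero_if_hd1:
  assumes Z: "finite Z"
    and hd: "K (card Z) \<inter> lowpart G fscale F (freeAct G) (card Z) \<subseteq> lowpart G fscale K (freeAct G) (card Z)"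
  shows "H1_zero Z"
  unfolding H1_zero_def
proof (intro allI impI, elim conjE)
  interpret K: fig_mod G fscale K "freeAct G" by (rule K_fig_mod)
  have KF: "c \<in> F m" if "c \<in> K m" for c m using that by (simp add: kerK_def)
  fix v assume v: "\<forall>z\<in>Z. v z \<in> V (card (Z - {z}))" and cyc: "(\<Sum>z\<in>Z. L (Z - {z}) Z (v z)) = 0"
  have "\<forall>z\<in>Z. \<exists>c. c \<in> F (card (Z - {z})) \<and> aug (card (Z - {z})) c = v z"
    using aug_lift v by blast
  from bchoice[OF this] obtain f where f: "\<And>z. z \<in> Z \<Longrightarrow> f z \<in> F (card (Z - {z}))"
    "\<And>z. z \<in> Z \<Longrightarrow> aug (card (Z - {z})) (f z) = v z" by blast
  \<comment> \<open>\<open>y\<close> measures how far the lift \<open>f\<close> is from a cycle. It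
    lies in \<open>K\<close> because \<open>v\<close> is a cycle, and in the low part of
    \<open>F\<close> by construction, so \<open>hd\<close> makes it a sum of faces of
    \<open>K\<close>.\<close>
  define y where "y = (\<Sum>z\<in>Z. F.L (Z - {z}) Z (f z))"
  have Lf: "F.L (Z - {z}) Z (f z) \<in> F (card Z)" if "z \<in> Z" for z
    using f(1)[OF that] Z by (intro F.L_in) auto
  have "aug (card Z) y = (\<Sum>z\<in>Z. L (Z - {z}) Z (v z))"
    unfolding y_def using Lf f Z by (simp add: aug_sum aug_L)
  then have "y \<in> K (card Z)"
    using cyc Lf unfolding kerK_def y_def by (auto intro: F.subspace_sum[OF F_subspace])
  moreover have "y \<in> lowpart G fscale F (freeAct G) (card Z)"
    unfolding y_def lowpart_def
    by (rule F.span_sum) (use F.face_in_lowpart[OF Z] f(1) in \<open>simp add: lowpart_def\<close>)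
  ultimately have "y \<in> K.faces Z Z" using hd K.lowpart_subset_faces[OF Z] by blast
  then obtain \<kappa> where \<kappa>: "\<And>z. z \<in> Z \<Longrightarrow> \<kappa> z \<in> K (card (Z - {z}))"
    and y\<kappa>: "y = (\<Sum>z\<in>Z. K.L (Z - {z}) Z (\<kappa> z))" by (elim K.facesE) blast
  have "K.L (Z - {z}) Z (\<kappa> z) = F.L (Z - {z}) Z (\<kappa> z)" if "z \<in> Z" for z
    using K.L_eq[OF Z _ \<kappa>[OF that]] F.L_eq[OF Z _ KF[OF \<kappa>[OF that]]] by auto
  then have "(\<Sum>z\<in>Z. F.L (Z - {z}) Z (f z - \<kappa> z)) = 0"
    using y\<kappa> by (simp add: F.M_diff sum_subtractf y_def)
  moreover have fk: "f z - \<kappa> z \<in> F (card (Z - {z}))" if "z \<in> Z" for z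
    using f(1)[OF that] KF[OF \<kappa>[OF that]] by (rule F.W_diff)
  ultimately obtain w where w: "F.alt2 Z w" and fw: "\<And>z. z \<in> Z \<Longrightarrow> f z - \<kappa> z = F.d2 Z w z"
    using F_H1_zero[OF Z, unfolded F.H1_zero_def, rule_format, of "\<lambda>z. f z - \<kappa> z"] by blast
  define w' where "w' x y = aug (card (Z - {x, y})) (w x y)" for x y
  have "alt2 Z w'"
    unfolding alt2_def
  proof (intro conjI ballI)
    fix x assume "x \<in> Z"
    then show "w' x x = 0" using F.alt2D(1)[OF w] by (simp add: w'_def aug_0)
  next
    fix x y assume xy: "x \<in> Z" "y \<in> Z"
    have eq: "Z - {y, x} = Z - {x, y}" by blast
    have "w y x \<in> F (card (Z - {x, y}))" using F.alt2D(3)[OF w xy(2,1)] unfolding eq .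
    then show "w' x y = - w' y x"
      unfolding w'_def eq F.alt2D(2)[OF w xy] by (rule aug_neg)
    show "w' x y \<in> V (card (Z - {x, y}))" unfolding w'_def using F.alt2D(3)[OF w xy] by (rule aug_in)
  qed
  moreover have "v z = d2 Z w' z" if z: "z \<in> Z" for z
  proof -
    \<comment> \<open>The correction lies in \<open>K\<close>, so the augmentation does not see
      it.\<close>
    have "v z = aug (card (Z - {z})) (f z + - \<kappa> z)"
      using f(2)[OF z] \<kappa>[OF z] KF[OF \<kappa>[OF z]]
      by (subst aug_add) (auto simp: f(1)[OF z] aug_neg kerK_def intro: F.W_neg)
    also have "\<dots> = aug (card (Z - {z})) (F.d2 Z w z)" using fw[OF z] by simp
    also have "\<dots> = d2 Z w' z"
      unfolding F.d2_def d2_def w'_def using F.alt2D(3)[OF w z] Z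
      by (subst aug_sum) (auto intro!: F.L_in sum.cong aug_L)
    finally show ?thesis .
  qed
  ultimately show "\<exists>w. alt2 Z w \<and> (\<forall>z\<in>Z. v z = d2 Z w z)" by blast
qed

end

section \<open>Degrees as suprema and the polynomial range\<close>

lemma degset_eq:
  "degset S = (if S = {} then - \<infinity> else if finite S then ereal (real (Max S)) else \<infinity>)"
proof -
  consider "S = {}" | "S \<noteq> {}" "finite S" | "infinite S" by blast
  then show ?thesis
  proof cases
    case 1
    then show ?thesis by (simp add: degset_def bot_ereal_def)
  next
    case 2
    have "Sup ((\<lambda>n. ereal (real n)) ` S) = ereal (real (Max S))"
      using 2 by (intro Sup_eqI) (auto intro!: Max_ge)
    then show ?thesis using 2 by (simp add: degset_def)
  next
    case 3
    have "degset S = \<infinity>"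
    proof (rule ereal_top)
      fix B :: real
      obtain N :: nat where N: "B \<le> real N" using real_arch_simple by blast
      obtain n where n: "n \<in> S" "N < n" using 3 by (meson infinite_nat_iff_unbounded)
      then have "ereal B \<le> ereal (real n)" using N by simp
      also have "\<dots> \<le> degset S" unfolding degset_def using n(1) by (rule SUP_upper)
      finally show "ereal B \<le> degset S" .
    qed
    then show ?thesis using 3 by auto
  qed
qed

theorem theoremD:
  fixes G :: "('g, 'b) monoid_scheme"
    and scale :: "'k::field \<Rightarrow> 'v::ab_group_add \<Rightarrow> 'v"
    and V :: "nat \<Rightarrow> 'v set"
    and act :: "nat \<Rightarrow> nat \<Rightarrow> 'g fimor \<Rightarrow> 'v \<Rightarrow> 'v"
  assumes "group G" and "finite (carrier G)"
    and "fig_module G scale V act"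
    and "fig_fin_gen G scale V act"
  shows "\<exists>P :: rat poly. \<forall>n::nat.
           ereal (real n) \<ge> hd1 G scale V act + min (hd1 G scale V act) (hd0 G scale V act)
           \<longrightarrow> of_nat (vector_space.dim scale (V n)) = poly P (of_nat n)"
proof -
  interpret fig_mod G scale V act
    using assms(1,3) by (simp add: fig_mod_def fig_mod_axioms_def)
  define S0 where "S0 = {n. lowpart G scale V act n \<noteq> V n}"
  define S1 where "S1 = {m. K m \<inter> lowpart G fscale F (freeAct G) m \<noteq> lowpart G fscale K (freeAct G) m}"
  have hd0: "hd0 G scale V act = degset S0" unfolding hd0_def S0_def ..
  have hd1: "hd1 G scale V act = degset S1" unfolding hd1_def S1_def ..
  obtain S where S: "finite S" "\<And>n v. (n, v) \<in> S \<Longrightarrow> v \<in> V n"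
    "\<And>m. V m = span (\<Union>(n, v)\<in>S. (\<lambda>\<phi>. act n m \<phi> v) ` homs G n m)"
    using assms(4) unfolding fig_fin_gen_def by blast
  \<comment> \<open>Above all degrees of the finitely many generators, each generator reaches
    \<open>V m\<close> from a lower degree.\<close>
  have "S0 \<subseteq> {..Max (insert 0 (fst ` S))}"
  proof
    fix m assume m: "m \<in> S0"
    show "m \<in> {..Max (insert 0 (fst ` S))}"
    proof (rule ccontr)
      assume "m \<notin> {..Max (insert 0 (fst ` S))}"
      then have m': "Max (insert 0 (fst ` S)) < m" by simp
      have lt: "n < m" if "(n, v) \<in> S" for n v
      proof -
        have "n \<in> insert 0 (fst ` S)" using that by force
        then have "n \<le> Max (insert 0 (fst ` S))" using S(1) by (intro Max_ge) auto
        then show ?thesis using m' by (rule le_less_trans)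
      qed
      have "(\<Union>(n, v)\<in>S. (\<lambda>\<phi>. act n m \<phi> v) ` homs G n m) \<subseteq>
          (\<Union>n\<in>{..<m}. \<Union>\<phi>\<in>homs G n m. act n m \<phi> ` V n)"
      proof clarify
        fix n v \<phi> assume nv: "(n, v) \<in> S" and \<phi>: "\<phi> \<in> homs G n m"
        show "act n m \<phi> v \<in> (\<Union>n\<in>{..<m}. \<Union>\<phi>\<in>homs G n m. act n m \<phi> ` V n)"
          by (rule UN_I[of n], use lt[OF nv] in simp, rule UN_I[OF \<phi>], rule imageI, rule S(2)[OF nv])
      qed
      then have "V m \<subseteq> lowpart G scale V act m"
        unfolding S(3)[of m] lowpart_def by (rule span_mono)
      then show False using m lowpart_subset[of m] by (auto simp: S0_def)
    qed
  qed
  then have fin0: "finite S0" by (rule finite_subset) simp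
  show ?thesis
  proof (cases "finite S1")
    case False
    \<comment> \<open>Here \<open>hd1\<close> is infinite, and extended real addition gives
      \<open>\<infinity>\<close> even for \<open>\<infinity> + (- \<infinity>)\<close>, so no
      \<open>n\<close> meets the bound.\<close>
    then have "\<not> hd1 G scale V act + min (hd1 G scale V act) (hd0 G scale V act) \<le> ereal (real n)" for n
      unfolding hd1 degset_eq[of S1] by auto
    then show ?thesis by blast
  next
    case fin1: True
    define D where "D = (if S0 = {} then 0 else Suc (Max S0))"
    define R where "R = (if S1 = {} then 0 else Suc (Max S1))"
    \<comment> \<open>When both degrees are finite, the differences are \<open>r\<close> and
      \<open>d\<close> themselves. Otherwise \<open>D = 0\<close> or \<open>R = 0\<close>, and the
      polynomial is valid in all degrees.\<close>
    define t where "t = (R - 1) + min (R - 1) (D - 1)"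
    have D: "n \<notin> S0" if "D \<le> n" for n
      using that Max_ge[OF fin0, of n] not_less_eq_eq[of "Max S0" n] unfolding D_def
      by (cases "S0 = {}") auto
    have R: "n \<notin> S1" if "R \<le> n" for n
      using that Max_ge[OF fin1, of n] not_less_eq_eq[of "Max S1" n] unfolding R_def
      by (cases "S1 = {}") auto
    interpret presented_fi_functor scale "\<lambda>X. V (card X)" set_act D R t
    proof unfold_locales
      show "V (card Z) \<subseteq> faces Z Z" if "finite Z" "D \<le> card Z" for Z
        using D[OF that(2)] lowpart_subset_faces[OF that(1)] by (simp add: S0_def)
      show "H1_zero Z" if "finite Z" "R \<le> card Z" for Z
        using R[OF that(2)] by (intro H1_zero_if_hd1[OF that(1)]) (simp add: S1_def)
      show "R + a \<le> t + 1" if "a < D" "a + 1 < R" for a using that unfolding t_def by linarith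
      show "\<exists>T. finite T \<and> V (card X) \<subseteq> span T" for X
        using S(3)[of "card X"] S(1) finite_homs[OF assms(2)]
        by (intro exI[of _ "\<Union>(n, v)\<in>S. (\<lambda>\<phi>. act n (card X) \<phi> v) ` homs G n (card X)"]) auto
    qed
    obtain P :: "rat poly" where P: "\<forall>Z::nat set. finite Z \<and> (D = 0 \<or> R \<le> 1 \<or> t \<le> card Z) \<longrightarrow>
        of_nat (dim (V (card Z))) = poly P (of_nat (card Z))"
      using dim_polynomial by blast
    have "of_nat (dim (V n)) = poly P (of_nat n)"
      if n: "hd1 G scale V act + min (hd1 G scale V act) (hd0 G scale V act) \<le> ereal (real n)" for n
    proof -
      have "D = 0 \<or> R \<le> 1 \<or> t \<le> n"
      proof (cases "S0 = {} \<or> S1 = {}")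
        case False
        define d r where "d = Max S0" and "r = Max S1"
        have "ereal (real r) + min (ereal (real r)) (ereal (real d)) \<le> ereal (real n)"
          using n False fin0 fin1 by (simp add: hd0 hd1 degset_eq d_def r_def)
        then have "r + min r d \<le> n" by (cases "r \<le> d") (auto simp: min_def)
        then have "t \<le> n" using False by (simp add: t_def D_def R_def d_def r_def)
        then show ?thesis by simp
      qed (auto simp: D_def R_def)
      \<comment> \<open>\<open>{..<n}\<close> represents the sets with \<open>n\<close>
        elements.\<close>
      then show ?thesis using P[rule_format, of "{..<n}"] by simp
    qed
    then show ?thesis by blast
  qed
qed

end
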